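(* Let $\mathcal{C}$ be the $[q+1,q-2,4]_q$ GDRS code ($q\ge 3$) whose parity check matrix has as columns nonzero scalar multiples of $(1,t,t^2)^{tr}$, $t\in\mathbb{F}_q$, and of $(0,0,1)^{tr}$ (the points of a conic $\mathcal{K}$ in $\mathrm{PG}(2,q)$). Put $n=q+1$. (i) Let $q$ be odd. Then $\mathcal{C}$ has covering radius $2$. It has $(q+1)(q-1)$ cosets of weight $1$, all with weight distribution $D_1$. Its weight $2$ cosets are partitioned into two classes: $(q-1)\frac{q^2+q}{2}$ cosets with weight distribution $D_2(i_1)$, $i_1=\frac{q-1}{2}$, and $(q-1)\frac{q^2-q}{2}$ cosets with weight distribution $D_2(i_2)$, $i_2=\frac{q+1}{2}$. For cosets $\mathcal{V}_a,\mathcal{V}_b$ in the two distinct classes, $$(-1)^{n}B_w(\mathcal{V}_a)-B_{n+2-w}(\mathcal{V}_a)=(-1)^{n}B_w(\mathcal{V}_b)-B_{n+2-w}(\mathcal{V}_b),\quad w=3,\ldots,n.$$ There are no cosets of weight $3$. (ii) Let $q$ be even. Then $\mathcal{C}$ has covering radius $3$. It has $(q+1)(q-1)$ cosets of weight $1$, all with weight distribution $D_1$; $(q-1)(q^2-1)$ cosets of weight $2$, all with weight distribution $D_2(i_1)$, $i_1=\frac q2$; and $q-1$ cosets of weight $3$, all with weight distribution $D_3$.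
   Context: For an $[n,n-3,4]_q$ code $\mathcal{C}$ (linear, length $n$, dimension $n-3$, minimum distance $4$), a coset is a translate $\mathcal{C}+\mathbf{v}$; its weight is the smallest Hamming weight of a vector in it. The covering radius is the least $R$ such that every vector of $\mathbb{F}_q^n$ is within Hamming distance $R$ of a codeword. $A_w(\mathcal{C})$ (resp. $B_w(\mathcal{V})$) is the number of vectors of Hamming weight $w$ in $\mathcal{C}$ (resp. in the coset $\mathcal{V}$). Put $\Omega_w^{(v)}(n,4)=(-1)^{w-4}\binom{n-v}{w-v}\binom{w-1-v}{2-v}$. A coset $\mathcal{V}$ has weight distribution: - $D_1$ if $B_0=B_2=0$, $B_1=1$, $B_3=\binom{n-1}{3}$, and $B_w=A_w(\mathcal{C})-\Omega_w^{(0)}(n,4)+\Omega_w^{(1)}(n,4)$ for $w=4,\ldots,n$; - $D_2(i)$ if $B_0=B_1=0$, $B_2=i$, and $B_w=A_w(\mathcal{C})-\Omega_w^{(0)}(n,4)+(-1)^w\binom{n-2}{n-w}i$ for $w=3,\ldots,n$; - $D_3$ if $B_0=B_1=B_2=0$, $B_3=\binom n3$, and $B_w=A_w(\mathcal{C})-\Omega_w^{(0)}(n,4)$ for $w=4,\ldots,n$; where $B_w=B_w(\mathcal{V})$. *)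

theory Defs
  imports "HOL-Analysis.Analysis"
begin

definition hamming_dist :: "'a ^ 'n \<Rightarrow> 'a ^ 'n \<Rightarrow> nat"
  where "hamming_dist x y = card {j. x $ j \<noteq> y $ j}"

definition hamming_weight :: "('a::zero) ^ 'n \<Rightarrow> nat"
  where "hamming_weight x = card {j. x $ j \<noteq> 0}"

definition min_distance :: "('a ^ 'n) set \<Rightarrow> nat"
  where "min_distance C = Min {hamming_dist x y | x y. x \<in> C \<and> y \<in> C \<and> x \<noteq> y}"

definition linear_code :: "nat \<Rightarrow> nat \<Rightarrow> nat \<Rightarrow> (('a::{field,finite}) ^ 'n) set \<Rightarrow> bool"
  where "linear_code n k d C \<longleftrightarrow>
    CARD('n) = n \<and> vec.subspace C \<and> vec.dim C = k \<and> min_distance C = d"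

definition covering_radius :: "('a ^ 'n) set \<Rightarrow> nat"
  where "covering_radius C = (LEAST R. \<forall>v. \<exists>c\<in>C. hamming_dist v c \<le> R)"

text \<open>The cosets include the code itself, which has weight 0.\<close>

definition cosets :: "(('a::plus) ^ 'n) set \<Rightarrow> ('a ^ 'n) set set"
  where "cosets C = {{c + v | c. c \<in> C} | v. True}"

definition coset_weight :: "(('a::zero) ^ 'n) set \<Rightarrow> nat"
  where "coset_weight V = (LEAST w. \<exists>x\<in>V. hamming_weight x = w)"

definition cosets_of_weight :: "nat \<Rightarrow> (('a::{zero,plus}) ^ 'n) set \<Rightarrow> ('a ^ 'n) set set"
  where "cosets_of_weight w C = {V \<in> cosets C. coset_weight V = w}"

text \<open>The number of vectors of weight \<open>w\<close> in a set; this is both \<open>A\<^sub>w(C)\<close>, for a code \<open>C\<close>,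
  and \<open>B\<^sub>w(V)\<close>, for a coset \<open>V\<close>.\<close>

definition weight_count :: "(('a::zero) ^ 'n) set \<Rightarrow> nat \<Rightarrow> nat"
  where "weight_count V w = card {x \<in> V. hamming_weight x = w}"

text \<open>\<open>Omega4 v w n\<close> is \<open>\<Omega>\<^sub>w\<^sup>(\<^sup>v\<^sup>)(n, 4)\<close>. Its sign is \<open>(-1)\<close> to the power \<open>w - 4\<close>, written here as
  \<open>(-1) ^ w\<close> because \<open>w = 3\<close> also occurs. It is used only for \<open>v \<le> 1\<close> and \<open>3 \<le> w \<le> n\<close>,
  where no natural-number subtraction truncates.\<close>

definition Omega4 :: "nat \<Rightarrow> nat \<Rightarrow> nat \<Rightarrow> int"
  where "Omega4 v w n =
    (-1) ^ w * int ((n - v) choose (w - v)) * int ((w - 1 - v) choose (2 - v))"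

definition distr_D1 :: "(('a::zero) ^ 'n) set \<Rightarrow> ('a ^ 'n) set \<Rightarrow> bool"
  where "distr_D1 C V \<longleftrightarrow>
    weight_count V 0 = 0 \<and> weight_count V 2 = 0 \<and> weight_count V 1 = 1 \<and>
    weight_count V 3 = (CARD('n) - 1) choose 3 \<and>
    (\<forall>w\<in>{4..CARD('n)}. int (weight_count V w) =
      int (weight_count C w) - Omega4 0 w CARD('n) + Omega4 1 w CARD('n))"

definition distr_D2 :: "nat \<Rightarrow> (('a::zero) ^ 'n) set \<Rightarrow> ('a ^ 'n) set \<Rightarrow> bool"
  where "distr_D2 i C V \<longleftrightarrow>
    weight_count V 0 = 0 \<and> weight_count V 1 = 0 \<and> weight_count V 2 = i \<and>
    (\<forall>w\<in>{3..CARD('n)}. int (weight_count V w) =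
      int (weight_count C w) - Omega4 0 w CARD('n)
        + (-1) ^ w * int ((CARD('n) - 2) choose (CARD('n) - w)) * int i)"

definition distr_D3 :: "(('a::zero) ^ 'n) set \<Rightarrow> ('a ^ 'n) set \<Rightarrow> bool"
  where "distr_D3 C V \<longleftrightarrow>
    weight_count V 0 = 0 \<and> weight_count V 1 = 0 \<and> weight_count V 2 = 0 \<and>
    weight_count V 3 = CARD('n) choose 3 \<and>
    (\<forall>w\<in>{4..CARD('n)}. int (weight_count V w) =
      int (weight_count C w) - Omega4 0 w CARD('n))"

fun conic_point :: "('a::field) option \<Rightarrow> 'a ^ 3"
  where
    "conic_point (Some t) = vector [1, t, t ^ 2]"
  | "conic_point None = vector [0, 0, 1]"

text \<open>The columns are nonzero multiples of the points of the conic, each point being used for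
  exactly one column, in any order.\<close>

definition gdrs_parity_check :: "('a::field) ^ 'n ^ 3 \<Rightarrow> bool"
  where "gdrs_parity_check H \<longleftrightarrow>
    (\<exists>(p :: 'n \<Rightarrow> 'a option) (u :: 'n \<Rightarrow> 'a). bij p \<and>
      (\<forall>j. u j \<noteq> 0 \<and> column j H = u j *s conic_point (p j)))"

definition code_of_parity_check :: "('a::field) ^ 'n ^ 'm \<Rightarrow> ('a ^ 'n) set"
  where "code_of_parity_check H = {x. H *v x = 0}"

end

theory Submission
  imports Defs "HOL-Number_Theory.Residues"
begin

text \<open>
  Cosets correspond to syndromes \<open>s \<in> F\<^sup>3\<close>. As any three columns of the parity check matrix are
  independent, the number of vectors with syndrome \<open>s\<close> supported in a given set of at least three
  positions does not depend on \<open>s\<close>; Moebius inversion over the supports then expresses the whole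
  weight distribution of a coset through its numbers \<open>B\<^sub>1\<close> and \<open>B\<^sub>2\<close> of vectors of weight 1 and 2.

  If \<open>s\<close> lies off the conic, then \<open>B\<^sub>2\<close> is the number of secants through \<open>s\<close>. Every conic point is
  either on exactly one of these secants or on a tangent through \<open>s\<close>, so \<open>2 B\<^sub>2\<close> plus the number of
  tangents is \<open>q + 1\<close>. The tangency condition is a quadratic equation, so there are at most two
  tangents if \<open>q\<close> is odd; if \<open>q\<close> is even there is at most one, unless \<open>s\<close> is the nucleus. Parity
  leaves 0 or 2 tangents, respectively 1. The sizes of the classes follow by counting all vectors of
  weight 2 by their syndromes.
\<close>

section \<open>Supports and weights\<close>

lemma card_vec_pointwise:
  fixes A :: "'n::finite \<Rightarrow> 'a::finite set"
  shows "card {x :: 'a ^ 'n. \<forall>j. x $ j \<in> A j} = (\<Prod>j\<in>UNIV. card (A j))"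
proof -
  have "bij_betw (\<lambda>x :: 'a ^ 'n. ($) x) {x. \<forall>j. x $ j \<in> A j} (PiE UNIV A)"
    by (rule bij_betwI[where g = vec_lambda]) (auto simp: PiE_iff vec_eq_iff)
  then show ?thesis
    by (simp add: bij_betw_same_card card_PiE)
qed

lemma card_support_subset:
  "card {x :: ('a::{zero,finite}) ^ 'n. {j. x $ j \<noteq> 0} \<subseteq> T} = CARD('a) ^ card T"
proof -
  have "{x :: 'a ^ 'n. {j. x $ j \<noteq> 0} \<subseteq> T} = {x. \<forall>j. x $ j \<in> (if j \<in> T then UNIV else {0})}"
    by auto
  then show ?thesis
    by (simp add: card_vec_pointwise if_distrib[of card] prod.If_cases)
qed

lemma card_support_eq:
  "card {x :: ('a::{zero,finite}) ^ 'n. {j. x $ j \<noteq> 0} = T} = (CARD('a) - 1) ^ card T"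
proof -
  have "{x :: 'a ^ 'n. {j. x $ j \<noteq> 0} = T}
      = {x. \<forall>j. x $ j \<in> (if j \<in> T then UNIV - {0} else {0})}"
    by (auto split: if_splits)
  then show ?thesis
    by (simp add: card_vec_pointwise if_distrib[of card] prod.If_cases)
qed

text \<open>The predicate \<open>P\<close> is left free because both the whole space and a single
  coset are split by supports later on.\<close>

lemma sum_split_by_support:
  fixes P :: "('a::{zero,finite}) ^ 'n \<Rightarrow> bool"
  assumes "finite \<S>"
  shows "(\<Sum>S\<in>\<S>. card {x. P x \<and> {j. x $ j \<noteq> 0} = S}) = card {x. P x \<and> {j. x $ j \<noteq> 0} \<in> \<S>}"
proof -
  have "{x. P x \<and> {j. x $ j \<noteq> 0} \<in> \<S>} = (\<Union>S\<in>\<S>. {x. P x \<and> {j. x $ j \<noteq> 0} = S})"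
    by auto
  then show ?thesis
    using assms by (subst card_UN_disjoint[symmetric]) auto
qed

lemma card_hamming_weight:
  "card {x :: ('a::{zero,finite}) ^ 'n. hamming_weight x = w}
    = (CARD('n) choose w) * (CARD('a) - 1) ^ w"
proof -
  have "card {x :: 'a ^ 'n. hamming_weight x = w}
      = (\<Sum>S | card S = w. card {x :: 'a ^ 'n. {j. x $ j \<noteq> 0} = S})"
    using sum_split_by_support[of "{S. card S = w}" "\<lambda>x :: 'a ^ 'n. True"]
    by (simp add: hamming_weight_def)
  also have "\<dots> = (\<Sum>S | card (S :: 'n set) = w. (CARD('a) - 1) ^ w)"
    by (simp add: card_support_eq)
  finally show ?thesis
    using n_subsets[of "UNIV :: 'n set" w] by simp
qed

text \<open>A superset of \<open>T\<close> of size \<open>w\<close> arises by adding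
  \<open>w - card T\<close> elements of the complement. The case distinction matters: for
  \<open>w < card T\<close> the truncated difference is 0 and the binomial coefficient would give 1
  instead of 0.\<close>

lemma card_supersets:
  fixes T :: "'n::finite set"
  shows "card {S. card S = w \<and> T \<subseteq> S} =
    (if card T \<le> w then (CARD('n) - card T) choose (w - card T) else 0)"
proof (cases "card T \<le> w")
  case True
  have "bij_betw (\<lambda>U. T \<union> U) {U. U \<subseteq> - T \<and> card U = w - card T} {S. card S = w \<and> T \<subseteq> S}"
  proof (rule bij_betwI[where g = "\<lambda>S. S - T"])
    show "(\<union>) T \<in> {U. U \<subseteq> - T \<and> card U = w - card T} \<rightarrow> {S. card S = w \<and> T \<subseteq> S}"
      using True by (auto simp: card_Un_disjoint disjoint_eq_subset_Compl Compl_subset_Compl_iff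
          subset_Compl_self_eq inf_commute)
    show "(\<lambda>S. S - T) \<in> {S. card S = w \<and> T \<subseteq> S} \<rightarrow> {U. U \<subseteq> - T \<and> card U = w - card T}"
      by (auto simp: card_Diff_subset)
  qed auto
  then have "card {S. card S = w \<and> T \<subseteq> S} = card (- T) choose (w - card T)"
    using n_subsets[of "- T"] by (simp add: bij_betw_same_card[symmetric])
  then show ?thesis
    using True by (simp add: Compl_eq_Diff_UNIV card_Diff_subset)
next
  case False
  then have "{S. card S = w \<and> T \<subseteq> S} = {}"
    using card_mono[of _ T] by fastforce
  then show ?thesis
    using False by (simp only: card.empty if_False)
qed

section \<open>Weights of vectors and of cosets\<close>

lemma hamming_weight_eq_0_iff [simp]: "hamming_weight x = 0 \<longleftrightarrow> x = 0"
  by (auto simp: hamming_weight_def vec_eq_iff)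

lemma hamming_weight_0 [simp]: "hamming_weight 0 = 0"
  by simp

lemma hamming_dist_conv_weight:
  fixes x y :: "('a::ab_group_add) ^ 'n"
  shows "hamming_dist x y = hamming_weight (x - y)"
  by (simp add: hamming_dist_def hamming_weight_def)

lemma hamming_weight_diff_le:
  fixes x y :: "('a::ab_group_add) ^ 'n"
  shows "hamming_weight (x - y) \<le> hamming_weight x + hamming_weight y"
proof -
  have "{j. (x - y) $ j \<noteq> 0} \<subseteq> {j. x $ j \<noteq> 0} \<union> {j. y $ j \<noteq> 0}"
    by auto
  then show ?thesis
    unfolding hamming_weight_def
    by (meson card_Un_le card_mono finite_UnI finite order_trans)
qed

lemma weight_count_eq_0_iff:
  fixes V :: "(('a::{zero,finite}) ^ 'n) set"
  shows "weight_count V w = 0 \<longleftrightarrow> (\<forall>x\<in>V. hamming_weight x \<noteq> w)"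
  by (auto simp: weight_count_def)

text \<open>Nonemptiness guarantees that the \<open>LEAST\<close> is attained, so the weight of a
  coset can be read off from its first nonzero weight count.\<close>

lemma coset_weight_eq_iff:
  fixes V :: "(('a::{zero,finite}) ^ 'n) set"
  assumes "V \<noteq> {}"
  shows "coset_weight V = w \<longleftrightarrow> weight_count V w \<noteq> 0 \<and> (\<forall>v<w. weight_count V v = 0)"
proof -
  obtain x where "x \<in> V"
    using assms by blast
  then have ex: "\<exists>w. \<exists>x\<in>V. hamming_weight x = w"
    by blast
  show ?thesis
  proof
    assume w: "coset_weight V = w"
    show "weight_count V w \<noteq> 0 \<and> (\<forall>v<w. weight_count V v = 0)"
      using LeastI_ex[OF ex] not_less_Least[where P = "\<lambda>w. \<exists>x\<in>V. hamming_weight x = w"]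
      by (auto simp: weight_count_eq_0_iff w[unfolded coset_weight_def, symmetric])
  next
    assume "weight_count V w \<noteq> 0 \<and> (\<forall>v<w. weight_count V v = 0)"
    then show "coset_weight V = w"
      unfolding weight_count_eq_0_iff coset_weight_def
      by (intro Least_equality) (auto intro: leI)
  qed
qed

lemma coset_weight_le_iff:
  fixes V :: "(('a::{zero,finite}) ^ 'n) set"
  assumes "V \<noteq> {}"
  shows "coset_weight V \<le> w \<longleftrightarrow> (\<exists>x\<in>V. hamming_weight x \<le> w)"
proof -
  have "\<exists>x\<in>V. hamming_weight x = coset_weight V" "\<forall>x\<in>V. \<not> hamming_weight x < coset_weight V"
    using coset_weight_eq_iff[OF assms, of "coset_weight V"]
    by (auto simp: weight_count_eq_0_iff)
  then show ?thesis
    by (metis leI le_trans order.refl)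
qed

section \<open>Omega as a combination of binomial coefficients\<close>

text \<open>The product is expanded by means of C(w-1,2) = C(w,2) - w + 1 and the absorption
  identities for w C(n,w) and C(w,2) C(n,w). The result uses exactly the binomials C(n-t,w-t), t =
  0, 1, 2, that Moebius inversion produces in \<open>weight_count_coset_of\<close>.\<close>

lemma Omega4_0:
  assumes "3 \<le> w"
  shows "Omega4 0 w n = (- 1) ^ w * (int (n choose w) - int n * int ((n - 1) choose (w - 1))
    + int (n choose 2) * int ((n - 2) choose (w - 2)))"
proof (cases "w \<le> n")
  case True
  have "int w * int (n choose w) = int n * int ((n - 1) choose (w - 1))"
    using assms times_binomial_minus1_eq[of w n] by (simp flip: of_nat_mult)
  moreover have "int (w choose 2) * int (n choose w) = int (n choose 2) * int ((n - 2) choose (w - 2))"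
    using assms True choose_mult[of 2 w n] by (simp add: mult.commute flip: of_nat_mult)
  moreover have "int (w choose 2) = int ((w - 1) choose 2) + int w - 1"
    using assms by (cases w) (auto simp: numeral_2_eq_2)
  ultimately have "int (n choose w) * int ((w - 1) choose 2)
      = int (n choose w) - int n * int ((n - 1) choose (w - 1))
        + int (n choose 2) * int ((n - 2) choose (w - 2))"
    by (simp add: algebra_simps)
  then show ?thesis
    by (simp add: Omega4_def)
next
  case False
  then show ?thesis
    using assms by (simp add: Omega4_def binomial_eq_0)
qed

text \<open>For v = 1 the second binomial is w - 2 = (w - 1) - 1, and absorption turns (w - 1)
  C(n-1,w-1) into (n - 1) C(n-2,w-2).\<close>

lemma Omega4_1:
  assumes "3 \<le> w" "1 \<le> n"
  shows "Omega4 1 w n = (- 1) ^ w * (int (n - 1) * int ((n - 2) choose (w - 2))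
    - int ((n - 1) choose (w - 1)))"
proof -
  have "int (w - 1) * int ((n - 1) choose (w - 1)) = int (n - 1) * int ((n - 1 - 1) choose (w - 1 - 1))"
    using assms times_binomial_minus1_eq[of "w - 1" "n - 1"] by (simp only: flip: of_nat_mult)
  moreover have "n - 1 - 1 = n - 2" "w - 1 - 1 = w - 2"
    by auto
  moreover have "int ((w - 1 - 1) choose (2 - 1)) = int (w - 1) - 1"
    using assms by simp
  ultimately have "int ((n - 1) choose (w - 1)) * int ((w - 1 - 1) choose (2 - 1))
      = int (n - 1) * int ((n - 2) choose (w - 2)) - int ((n - 1) choose (w - 1))"
    by (simp only: left_diff_distrib mult.commute[of "int ((n - 1) choose (w - 1))"] mult_1_left)
  then show ?thesis
    unfolding Omega4_def by (simp only: mult.assoc)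
qed

section \<open>Codes whose parity check matrix has any three columns independent\<close>

text \<open>Independence of any three columns is phrased as the absence of nonzero words of weight
  at most 3 in the kernel. The length bound provides four positions, hence a codeword of weight
  exactly 4.\<close>

locale mds_check =
  fixes H :: "('a::{field,finite}) ^ 'n ^ 3"
  assumes independent: "hamming_weight x \<le> 3 \<Longrightarrow> H *v x = 0 \<Longrightarrow> x = 0"
    and length_ge: "4 \<le> CARD('n)"
begin

text \<open>Cosets are indexed by syndromes; \<open>coset_of 0\<close> is the code itself.\<close>

definition coset_of :: "'a ^ 3 \<Rightarrow> ('a ^ 'n) set"
  where "coset_of s = {x. H *v x = s}"

text \<open>By independence the syndrome map is injective on the vectors supported in
  \<open>T\<close>. There are as many of these as syndromes, namely the cube of the field size, so
  the map is also onto.\<close>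

lemma exists_supported:
  assumes "card T = 3"
  shows "\<exists>x. {j. x $ j \<noteq> 0} \<subseteq> T \<and> H *v x = s"
proof -
  let ?X = "{x :: 'a ^ 'n. {j. x $ j \<noteq> 0} \<subseteq> T}"
  have "inj_on ((*v) H) ?X"
  proof (rule inj_onI)
    fix x y assume "x \<in> ?X" "y \<in> ?X" and eq: "H *v x = H *v y"
    then have "{j. (x - y) $ j \<noteq> 0} \<subseteq> T"
      by (auto; metis (mono_tags) mem_Collect_eq subsetD)
    then have "hamming_weight (x - y) \<le> 3"
      using assms card_mono[of T] by (simp add: hamming_weight_def)
    moreover have "H *v (x - y) = 0"
      using eq by (simp add: matrix_vector_mult_diff_distrib)
    ultimately show "x = y"
      using independent[of "x - y"] by simp
  qed
  then have "card ((*v) H ` ?X) = CARD('a ^ 3)"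
    by (simp add: card_image card_support_subset assms)
  then have "(*v) H ` ?X = UNIV"
    by (intro card_subset_eq) auto
  then have "s \<in> (*v) H ` ?X"
    by simp
  then show ?thesis
    by auto
qed

lemma exists_weight_le_3: "\<exists>x\<in>coset_of s. hamming_weight x \<le> 3"
proof -
  obtain T :: "'n set" where T: "card T = 3"
    using length_ge obtain_subset_with_card_n[of 3 "UNIV :: 'n set"] by auto
  from exists_supported[OF this] obtain x where "{j. x $ j \<noteq> 0} \<subseteq> T" "H *v x = s"
    by blast
  with T show ?thesis
    using card_mono[of T] by (intro bexI[of _ x]) (auto simp: coset_of_def hamming_weight_def)
qed

lemma coset_of_nonempty: "coset_of s \<noteq> {}"
  using exists_weight_le_3 by blast

lemma inj_coset_of: "inj coset_of"
proof (rule injI)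
  fix s t assume "coset_of s = coset_of t"
  moreover obtain x where "x \<in> coset_of s"
    using coset_of_nonempty by blast
  ultimately have "x \<in> coset_of s" "x \<in> coset_of t"
    by auto
  then show "s = t"
    by (simp add: coset_of_def)
qed

text \<open>The difference of the two vectors is a codeword of weight at most 3, hence zero.\<close>

lemma coset_of_eqI:
  assumes "x \<in> coset_of s" "y \<in> coset_of s" "hamming_weight x + hamming_weight y \<le> 3"
  shows "x = y"
proof -
  have "H *v (x - y) = 0"
    using assms by (simp add: coset_of_def matrix_vector_mult_diff_distrib)
  then show ?thesis
    using assms(3) hamming_weight_diff_le[of x y] independent[of "x - y"] by simp
qed

text \<open>The translate by \<open>v\<close> is the fibre of the syndrome of \<open>v\<close>, and
  every syndrome occurs since no fibre is empty. With \<open>inj_coset_of\<close>, counting cosets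
  becomes counting syndromes.\<close>

lemma cosets_eq: "cosets (coset_of 0) = range coset_of"
proof -
  have coset: "{c + v |c. c \<in> coset_of 0} = coset_of (H *v v)" for v
  proof (intro equalityI subsetI)
    fix x assume "x \<in> coset_of (H *v v)"
    then have "x - v \<in> coset_of 0"
      by (simp add: coset_of_def matrix_vector_mult_diff_distrib)
    then show "x \<in> {c + v |c. c \<in> coset_of 0}"
      by (metis (mono_tags, lifting) diff_add_cancel mem_Collect_eq)
  qed (auto simp: coset_of_def matrix_vector_right_distrib)
  have "s \<in> range ((*v) H)" for s
    using coset_of_nonempty[of s] by (auto simp: coset_of_def)
  then show ?thesis
    unfolding cosets_def coset by (auto simp: full_SetCompr_eq image_iff) metis
qed

lemma cosets_of_weight_eq:
  "cosets_of_weight w (coset_of 0) = coset_of ` {s. coset_weight (coset_of s) = w}"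
  by (auto simp: cosets_of_weight_def cosets_eq)

lemma card_cosets_of_weight:
  "card (cosets_of_weight w (coset_of 0)) = card {s. coset_weight (coset_of s) = w}"
  by (simp add: cosets_of_weight_eq card_image inj_on_subset[OF inj_coset_of])

text \<open>The differences \<open>v - c\<close> with \<open>c\<close> in the code are exactly the
  vectors of the coset of \<open>v\<close>, so the distance of \<open>v\<close> from the code is the
  weight of that coset.\<close>

lemma covering_radius_eq: "covering_radius (coset_of 0) = (LEAST R. \<forall>s. coset_weight (coset_of s) \<le> R)"
proof -
  have *: "(\<exists>c\<in>coset_of 0. hamming_dist v c \<le> R) \<longleftrightarrow> coset_weight (coset_of (H *v v)) \<le> R" for v R
  proof
    assume "\<exists>c\<in>coset_of 0. hamming_dist v c \<le> R"
    then obtain c where "c \<in> coset_of 0" "hamming_weight (v - c) \<le> R"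
      by (auto simp: hamming_dist_conv_weight)
    then show "coset_weight (coset_of (H *v v)) \<le> R"
      unfolding coset_weight_le_iff[OF coset_of_nonempty]
      by (intro bexI[of _ "v - c"]) (auto simp: coset_of_def matrix_vector_mult_diff_distrib)
  next
    assume "coset_weight (coset_of (H *v v)) \<le> R"
    then obtain x where "x \<in> coset_of (H *v v)" "hamming_weight x \<le> R"
      unfolding coset_weight_le_iff[OF coset_of_nonempty] by blast
    then show "\<exists>c\<in>coset_of 0. hamming_dist v c \<le> R"
      by (intro bexI[of _ "v - x"])
        (auto simp: coset_of_def matrix_vector_mult_diff_distrib hamming_dist_conv_weight)
  qed
  have "(\<forall>v. coset_weight (coset_of (H *v v)) \<le> R) \<longleftrightarrow> (\<forall>s. coset_weight (coset_of s) \<le> R)" for R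
  proof (intro iffI allI)
    fix s assume "\<forall>v. coset_weight (coset_of (H *v v)) \<le> R"
    moreover obtain v where "v \<in> coset_of s"
      using coset_of_nonempty by blast
    ultimately show "coset_weight (coset_of s) \<le> R"
      by (auto simp: coset_of_def)
  qed simp
  then show ?thesis
    unfolding covering_radius_def * by simp
qed

lemma covering_radius_eqI:
  assumes "\<And>s. coset_weight (coset_of s) \<le> r" "card {s. coset_weight (coset_of s) = r} \<noteq> 0"
  shows "covering_radius (coset_of 0) = r"
proof -
  obtain s where s: "coset_weight (coset_of s) = r"
    using assms(2) by (metis (mono_tags, lifting) card_eq_0_iff empty_Collect_eq)
  show ?thesis
    unfolding covering_radius_eq
  proof (rule Least_equality)
    fix R assume "\<forall>s. coset_weight (coset_of s) \<le> R"
    then show "r \<le> R"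
      using s by blast
  qed (simp add: assms(1))
qed

lemma coset_weight_le_3: "coset_weight (coset_of s) \<le> 3"
  using exists_weight_le_3 coset_weight_le_iff[OF coset_of_nonempty] by blast

section \<open>The parameters of the code\<close>

lemma subspace_coset_of_0: "vec.subspace (coset_of 0)"
  by (auto simp: vec.subspace_def coset_of_def matrix_vector_right_distrib vector_scalar_commute)

text \<open>Erasing three coordinates maps the code isomorphically onto the vectors vanishing there:
  injectively by independence, and onto because the three erased coordinates can correct any
  syndrome.\<close>

lemma dim_coset_of_0: "vec.dim (coset_of 0) = CARD('n) - 3"
proof -
  obtain T :: "'n set" where T: "card T = 3"
    using length_ge obtain_subset_with_card_n[of 3 "UNIV :: 'n set"] by auto
  define f :: "'a ^ 'n \<Rightarrow> 'a ^ 'n" where "f x = (\<chi> j. if j \<in> T then 0 else x $ j)" for x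
  have lin: "Vector_Spaces.linear (*s) (*s) f"
    by (unfold_locales) (auto simp: f_def vec_eq_iff algebra_simps)
  have inj: "inj_on f (coset_of 0)"
  proof (rule inj_onI)
    fix x y assume "x \<in> coset_of 0" "y \<in> coset_of 0" and eq: "f x = f y"
    have "{j. (x - y) $ j \<noteq> 0} \<subseteq> T"
      using eq by (auto simp: f_def vec_eq_iff) metis
    then have "hamming_weight (x - y) \<le> 3"
      using T card_mono[of T] by (simp add: hamming_weight_def)
    moreover have "H *v (x - y) = 0"
      using \<open>x \<in> coset_of 0\<close> \<open>y \<in> coset_of 0\<close> by (simp add: coset_of_def matrix_vector_mult_diff_distrib)
    ultimately show "x = y"
      using independent[of "x - y"] by simp
  qed
  have "f ` coset_of 0 = {y. \<forall>j. j \<notin> - T \<longrightarrow> y $ j = 0}"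
  proof (intro equalityI subsetI)
    fix y :: "'a ^ 'n" assume y: "y \<in> {y. \<forall>j. j \<notin> - T \<longrightarrow> y $ j = 0}"
    obtain x where x: "{j. x $ j \<noteq> 0} \<subseteq> T" "H *v x = H *v y"
      using exists_supported[OF T] by blast
    have "y = f (y - x)"
      using x y by (auto simp: f_def vec_eq_iff)
    moreover have "y - x \<in> coset_of 0"
      using x by (simp add: coset_of_def matrix_vector_mult_diff_distrib)
    ultimately show "y \<in> f ` coset_of 0"
      by blast
  qed (auto simp: f_def)
  then have "vec.dim (f ` coset_of 0) = card (- T)"
    by (simp only: dim_substandard_cart)
  moreover have "vec.dim (f ` coset_of 0) = vec.dim (coset_of 0)"
    using inj subspace_coset_of_0 by (intro vec.dim_image_eq[OF lin]) (simp only: vec.span_eq_iff[THEN iffD2])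
  ultimately show ?thesis
    using T by (simp add: Compl_eq_Diff_UNIV card_Diff_subset)
qed

lemma min_distance_coset_of_0: "min_distance (coset_of 0) = 4"
proof -
  let ?D = "{hamming_dist x y |x y. x \<in> coset_of 0 \<and> y \<in> coset_of 0 \<and> x \<noteq> y}"
  have ge: "4 \<le> hamming_dist x y" if "x \<in> coset_of 0" "y \<in> coset_of 0" "x \<noteq> y" for x y
    using that independent[of "x - y"]
    by (fastforce simp: hamming_dist_conv_weight coset_of_def matrix_vector_mult_diff_distrib)
  obtain T :: "'n set" where T: "card T = 4"
    using length_ge obtain_subset_with_card_n[of 4 "UNIV :: 'n set"] by auto
  then obtain k where k: "k \<in> T"
    by fastforce
  then have "card (T - {k}) = 3"
    using T by simp
  \<comment> \<open>Column \<open>k\<close> is written as a combination of the other three columns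
    in \<open>T\<close>; the difference of the two sides is a codeword supported in
    \<open>T\<close>. It is nonzero since its coordinate at \<open>k\<close> is -1.\<close>
  from exists_supported[OF this] obtain x
    where x: "{j. x $ j \<noteq> 0} \<subseteq> T - {k}" "H *v x = H *v axis k 1"
    by blast
  have "{j. (x - axis k 1) $ j \<noteq> 0} \<subseteq> T"
    using x(1) k by (auto simp: axis_def split: if_splits)
  then have "hamming_weight (x - axis k 1) \<le> 4"
    using T card_mono[of T] by (simp add: hamming_weight_def)
  then have le: "hamming_dist x (axis k 1) \<le> 4"
    by (simp add: hamming_dist_conv_weight)
  have "x \<noteq> axis k 1"
    using x(1) by (auto simp: axis_nth subset_iff dest: spec[of _ k])
  moreover have "x - axis k 1 \<in> coset_of 0" "0 \<in> coset_of 0"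
    using x(2) by (auto simp: coset_of_def matrix_vector_mult_diff_distrib)
  ultimately have "hamming_dist (x - axis k 1) 0 \<in> ?D"
    by (metis (mono_tags, lifting) eq_iff_diff_eq_0 mem_Collect_eq)
  moreover have "hamming_dist (x - axis k 1) 0 = 4"
    using ge[of "x - axis k 1" 0] le \<open>x \<noteq> axis k 1\<close> \<open>x - axis k 1 \<in> coset_of 0\<close> \<open>0 \<in> coset_of 0\<close>
    by (simp add: hamming_dist_conv_weight)
  moreover have "finite ?D"
    by (rule finite_subset[of _ "(\<lambda>(x, y). hamming_dist x y) ` UNIV"]) auto
  ultimately show ?thesis
    unfolding min_distance_def using ge by (intro Min_eqI) auto
qed

lemma linear_code_coset_of_0: "linear_code CARD('n) (CARD('n) - 3) 4 (coset_of 0)"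
  by (simp add: linear_code_def subspace_coset_of_0 dim_coset_of_0 min_distance_coset_of_0)

section \<open>The weight distribution of a coset by Moebius inversion\<close>

text \<open>Three positions of \<open>S\<close> already support a vector \<open>y\<close> of
  syndrome \<open>s\<close>, and translation by \<open>y\<close> preserves being supported in
  \<open>S\<close>.\<close>

lemma card_supported_ge_3:
  assumes "3 \<le> card S"
  shows "card {x \<in> coset_of s. {j. x $ j \<noteq> 0} \<subseteq> S} = card {x \<in> coset_of 0. {j. x $ j \<noteq> 0} \<subseteq> S}"
proof -
  obtain T where T: "T \<subseteq> S" "card T = 3"
    using assms obtain_subset_with_card_n[of 3 S] by auto
  then obtain y where y: "{j. y $ j \<noteq> 0} \<subseteq> S" "H *v y = s"
    using exists_supported[of T s] by blast
  have y0: "y $ j = 0" if "j \<notin> S" for j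
    using y that by blast
  have "bij_betw (\<lambda>x. x - y) {x \<in> coset_of s. {j. x $ j \<noteq> 0} \<subseteq> S} {x \<in> coset_of 0. {j. x $ j \<noteq> 0} \<subseteq> S}"
  proof (rule bij_betwI[where g = "\<lambda>x. x + y"])
    show "(\<lambda>x. x - y) \<in> {x \<in> coset_of s. {j. x $ j \<noteq> 0} \<subseteq> S} \<rightarrow> {x \<in> coset_of 0. {j. x $ j \<noteq> 0} \<subseteq> S}"
    proof (intro funcsetI CollectI conjI subsetI)
      fix x j assume x: "x \<in> {x \<in> coset_of s. {j. x $ j \<noteq> 0} \<subseteq> S}"
      show "x - y \<in> coset_of 0"
        using x y by (simp add: coset_of_def matrix_vector_mult_diff_distrib)
      assume "j \<in> {j. (x - y) $ j \<noteq> 0}"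
      then show "j \<in> S"
        using x y0[of j] by auto
    qed
    show "(\<lambda>x. x + y) \<in> {x \<in> coset_of 0. {j. x $ j \<noteq> 0} \<subseteq> S} \<rightarrow> {x \<in> coset_of s. {j. x $ j \<noteq> 0} \<subseteq> S}"
    proof (intro funcsetI CollectI conjI subsetI)
      fix x j assume x: "x \<in> {x \<in> coset_of 0. {j. x $ j \<noteq> 0} \<subseteq> S}"
      show "x + y \<in> coset_of s"
        using x y by (simp add: coset_of_def matrix_vector_right_distrib)
      assume "j \<in> {j. (x + y) $ j \<noteq> 0}"
      then show "j \<in> S"
        using x y0[of j] by auto
    qed
  qed simp_all
  then show ?thesis
    by (rule bij_betw_same_card)
qed

lemma card_supported_le_3:
  assumes "card S \<le> 3"
  shows "card {x \<in> coset_of 0. {j. x $ j \<noteq> 0} \<subseteq> S} = 1"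
proof -
  have "x = 0" if "x \<in> coset_of 0" "{j. x $ j \<noteq> 0} \<subseteq> S" for x
    using that assms card_mono[of S "{j. x $ j \<noteq> 0}"] independent[of x]
    by (simp add: coset_of_def hamming_weight_def)
  then have "{x \<in> coset_of 0. {j. x $ j \<noteq> 0} \<subseteq> S} = {0}"
    by (auto simp: coset_of_def)
  then show ?thesis
    by simp
qed

text \<open>Double counting of the pairs of a vector \<open>x\<close> in the coset and a
  \<open>t\<close>-set \<open>T\<close> containing its support.\<close>

lemma sum_card_supported:
  "(\<Sum>T | card T = t. card {x \<in> coset_of s. {j. x $ j \<noteq> 0} \<subseteq> T})
    = (\<Sum>v\<le>t. weight_count (coset_of s) v * ((CARD('n) - v) choose (t - v)))"
proof -
  have "(\<Sum>T | card T = t. card {x \<in> coset_of s. {j. x $ j \<noteq> 0} \<subseteq> T})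
      = (\<Sum>T | card T = t. \<Sum>x | x \<in> coset_of s \<and> {j. x $ j \<noteq> 0} \<subseteq> T. 1)"
    by simp
  also have "\<dots> = (\<Sum>x\<in>coset_of s. \<Sum>T | T \<in> {T. card T = t} \<and> {j. x $ j \<noteq> 0} \<subseteq> T. 1)"
    by (rule sum.swap_restrict) auto
  also have "\<dots> = (\<Sum>x\<in>coset_of s. card {T. card T = t \<and> {j. x $ j \<noteq> 0} \<subseteq> T})"
    by simp
  also have "\<dots> = (\<Sum>x\<in>coset_of s. if hamming_weight x \<le> t
      then (CARD('n) - hamming_weight x) choose (t - hamming_weight x) else 0)"
    by (simp only: card_supersets hamming_weight_def)
  also have "\<dots> = (\<Sum>x | x \<in> coset_of s \<and> hamming_weight x \<in> {..t}.
      (CARD('n) - hamming_weight x) choose (t - hamming_weight x))"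
    by (simp add: sum.inter_filter)
  also have "\<dots> = (\<Sum>v\<le>t. \<Sum>x | x \<in> {x. x \<in> coset_of s \<and> hamming_weight x \<in> {..t}} \<and> hamming_weight x = v.
      (CARD('n) - hamming_weight x) choose (t - hamming_weight x))"
    by (rule sum.group[symmetric]) auto
  also have "\<dots> = (\<Sum>v\<le>t. \<Sum>x | x \<in> coset_of s \<and> hamming_weight x = v. (CARD('n) - v) choose (t - v))"
    by (intro sum.cong) auto
  finally show ?thesis
    by (simp add: weight_count_def)
qed

lemma card_support_eq_inclusion_exclusion:
  "int (card {x \<in> coset_of s. {j. x $ j \<noteq> 0} = S})
    = (\<Sum>T\<in>Pow S. (- 1) ^ (card S - card T) * int (card {x \<in> coset_of s. {j. x $ j \<noteq> 0} \<subseteq> T}))"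
proof (rule inclusion_exclusion_mobius[where g = "\<lambda>S. int (card {x \<in> coset_of s. {j. x $ j \<noteq> 0} \<subseteq> S})"])
  fix S :: "'n set" assume "finite S"
  then show "int (card {x \<in> coset_of s. {j. x $ j \<noteq> 0} \<subseteq> S})
      = (\<Sum>T\<in>Pow S. int (card {x \<in> coset_of s. {j. x $ j \<noteq> 0} = T}))"
    using sum_split_by_support[of "Pow S" "\<lambda>x. x \<in> coset_of s"] by (simp flip: of_nat_sum)
qed simp

text \<open>Both weight counts are written by Moebius inversion over supports and subtracted.
  Supports of size at least 3 cancel, so only sizes 0, 1, 2 remain, and these depend only on
  \<open>B_1\<close> and \<open>B_2\<close> of the coset.\<close>

lemma weight_count_coset_of:
  assumes "s \<noteq> 0" "2 \<le> w"
  shows "int (weight_count (coset_of s) w) = int (weight_count (coset_of 0) w) + (- 1) ^ w *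
    (int ((CARD('n) - 1) choose (w - 1)) * (int CARD('n) - int (weight_count (coset_of s) 1))
     - int (CARD('n) choose w)
     + int ((CARD('n) - 2) choose (w - 2)) *
       (int (weight_count (coset_of s) 2) + (int CARD('n) - 1) * int (weight_count (coset_of s) 1)
        - int (CARD('n) choose 2)))"
proof -
  define N where "N r T = int (card {x \<in> coset_of r. {j. x $ j \<noteq> 0} \<subseteq> T})" for r T
  define M where "M T = N s T - N 0 T" for T
  have M_ge: "M T = 0" if "3 \<le> card T" for T
    using card_supported_ge_3[OF that, of s] by (simp add: M_def N_def)
  have N0: "N 0 T = 1" if "card T \<le> 3" for T
    using card_supported_le_3[OF that] by (simp add: N_def)
  have wc: "int (weight_count (coset_of r) w) = (\<Sum>S | card S = w. \<Sum>T\<in>Pow S. (- 1) ^ (w - card T) * N r T)" for r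
  proof -
    have "weight_count (coset_of r) w = (\<Sum>S | card S = w. card {x \<in> coset_of r. {j. x $ j \<noteq> 0} = S})"
      using sum_split_by_support[of "{S. card S = w}" "\<lambda>x. x \<in> coset_of r"]
      by (simp add: weight_count_def hamming_weight_def)
    then have "int (weight_count (coset_of r) w)
        = (\<Sum>S | card S = w. int (card {x \<in> coset_of r. {j. x $ j \<noteq> 0} = S}))"
      by simp
    then show ?thesis
      unfolding card_support_eq_inclusion_exclusion by (simp add: N_def)
  qed
  \<comment> \<open>For these small \<open>T\<close> the zero word is the only codeword supported in
    \<open>T\<close>, so the code contributes 1 for each \<open>T\<close>.\<close>
  have M_sum: "(\<Sum>T | card T = t. M T) =
      (\<Sum>v\<le>t. int (weight_count (coset_of s) v) * int ((CARD('n) - v) choose (t - v)))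
      - int (CARD('n) choose t)" if "t \<le> 2" for t
  proof -
    have "(\<Sum>T | card T = t. M T) = (\<Sum>T | card T = t. N s T) - (\<Sum>T | card (T :: 'n set) = t. 1)"
      using that by (simp add: M_def sum_subtractf N0)
    moreover have "(\<Sum>T | card T = t. N s T)
        = (\<Sum>v\<le>t. int (weight_count (coset_of s) v) * int ((CARD('n) - v) choose (t - v)))"
      using arg_cong[OF sum_card_supported[of s t], of int] by (simp add: N_def)
    ultimately show ?thesis
      using n_subsets[of "UNIV :: 'n set" t] by simp
  qed
  have B0: "weight_count (coset_of s) 0 = 0"
    using assms(1) by (auto simp: weight_count_eq_0_iff coset_of_def)
  \<comment> \<open>The order of summation is exchanged so that each \<open>T\<close> is weighted by
    the number of its supersets of size \<open>w\<close>; then the vanishing of \<open>M\<close> for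
    sizes from 3 on truncates the sum.\<close>
  have "int (weight_count (coset_of s) w) - int (weight_count (coset_of 0) w)
      = (\<Sum>S | card S = w. \<Sum>T | T \<in> UNIV \<and> T \<subseteq> S. (- 1) ^ (w - card T) * M T)"
    by (simp add: wc M_def Pow_def sum_subtractf algebra_simps)
  also have "\<dots> = (\<Sum>T\<in>UNIV. \<Sum>S | S \<in> {S. card S = w} \<and> T \<subseteq> S. (- 1) ^ (w - card T) * M T)"
    by (rule sum.swap_restrict) auto
  also have "\<dots> = (\<Sum>T\<in>UNIV. int (card {S. card S = w \<and> T \<subseteq> S}) * ((- 1) ^ (w - card T) * M T))"
    by simp
  also have "\<dots> = (\<Sum>T | card T \<in> {..2}. int (card {S. card S = w \<and> T \<subseteq> S}) * ((- 1) ^ (w - card T) * M T))"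
    by (rule sum.mono_neutral_right) (auto simp: M_ge)
  also have "\<dots> = (\<Sum>t\<le>2. \<Sum>T | T \<in> {T. card T \<in> {..2}} \<and> card T = t.
      int (card {S. card S = w \<and> T \<subseteq> S}) * ((- 1) ^ (w - card T) * M T))"
    by (rule sum.group[symmetric]) auto
  also have "\<dots> = (\<Sum>t\<le>2. \<Sum>T | card T = t.
      int ((CARD('n) - t) choose (w - t)) * (- 1) ^ (w - t) * M T)"
    \<comment> \<open>Since \<open>w\<close> is at least 2, the nonzero branch of
      \<open>card_supersets\<close> applies to every remaining \<open>T\<close>.\<close>
    using assms(2) by (intro sum.cong) (auto simp: card_supersets)
  also have "\<dots> = (\<Sum>t\<le>2. int ((CARD('n) - t) choose (w - t)) * (- 1) ^ (w - t) * (\<Sum>T | card T = t. M T))"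
    by (simp add: sum_distrib_left)
  also have "\<dots> = (\<Sum>t\<le>2. int ((CARD('n) - t) choose (w - t)) * (- 1) ^ (w - t) *
    ((\<Sum>v\<le>t. int (weight_count (coset_of s) v) * int ((CARD('n) - v) choose (t - v)))
      - int (CARD('n) choose t)))"
    by (intro sum.cong) (auto simp: M_sum)
  also have "\<dots> = (- 1) ^ w *
    (int ((CARD('n) - 1) choose (w - 1)) * (int CARD('n) - int (weight_count (coset_of s) 1))
     - int (CARD('n) choose w)
     + int ((CARD('n) - 2) choose (w - 2)) *
       (int (weight_count (coset_of s) 2) + (int CARD('n) - 1) * int (weight_count (coset_of s) 1)
        - int (CARD('n) choose 2)))"
  proof -
    \<comment> \<open>This form of \<open>w\<close> resolves the subtractions in the exponents and
      lower indices for t = 0, 1, 2.\<close>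
    obtain k where k: "w = Suc (Suc k)"
      using assms(2) by (metis add_2_eq_Suc le_Suc_ex)
    show ?thesis
      using length_ge by (simp add: k B0 numeral_2_eq_2 of_nat_diff algebra_simps)
  qed
  finally show ?thesis
    by simp
qed

lemma weight_count_coset_of_0_eq_0:
  assumes "0 < w" "w \<le> 3"
  shows "weight_count (coset_of 0) w = 0"
proof -
  have "hamming_weight x \<noteq> w" if "x \<in> coset_of 0" for x
    using assms that independent[of x] by (auto simp: coset_of_def)
  then show ?thesis
    by (simp add: weight_count_eq_0_iff)
qed

section \<open>Weight distributions of the cosets of weight 1, 2 and 3\<close>

lemma weight_count_coset_of_0: "weight_count (coset_of s) 0 = (if s = 0 then 1 else 0)"
proof -
  have "{x \<in> coset_of s. hamming_weight x = 0} = (if s = 0 then {0} else {})"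
    by (auto simp: coset_of_def)
  then show ?thesis
    by (simp add: weight_count_def)
qed

text \<open>A vector of weight 1 and one of weight at most 2 in the same coset differ by a codeword
  of weight at most 3, so they coincide.\<close>

lemma weight_count_coset_weight_1:
  assumes "coset_weight (coset_of s) = 1"
  shows "weight_count (coset_of s) 1 = 1" "weight_count (coset_of s) 2 = 0"
proof -
  obtain x where x: "x \<in> coset_of s" "hamming_weight x = 1"
    using assms coset_weight_eq_iff[OF coset_of_nonempty, of s 1] by (auto simp: weight_count_eq_0_iff)
  have unique: "y = x" if "y \<in> coset_of s" "hamming_weight y \<le> 2" for y
    using that x by (intro coset_of_eqI[of y s x]) auto
  have "{y \<in> coset_of s. hamming_weight y = 1} = {x}"
  proof (intro equalityI subsetI)
    fix y assume "y \<in> {y \<in> coset_of s. hamming_weight y = 1}"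
    then show "y \<in> {x}"
      using unique[of y] by (simp only: mem_Collect_eq singleton_iff)
  qed (simp add: x)
  then show "weight_count (coset_of s) 1 = 1"
    by (simp add: weight_count_def)
  have "hamming_weight y \<noteq> 2" if "y \<in> coset_of s" for y
  proof
    assume "hamming_weight y = 2"
    with unique[OF that] x(2) show False
      by simp
  qed
  then show "weight_count (coset_of s) 2 = 0"
    by (simp add: weight_count_eq_0_iff)
qed

lemma syndrome_nonzero:
  assumes "coset_weight (coset_of s) > 0"
  shows "s \<noteq> 0"
proof
  assume "s = 0"
  then have "coset_weight (coset_of s) = 0"
    by (simp add: coset_weight_eq_iff[OF coset_of_nonempty] weight_count_coset_of_0)
  with assms show False
    by simp
qed

text \<open>Substituting \<open>B_1 = 1\<close> and \<open>B_2 = 0\<close> into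
  \<open>weight_count_coset_of\<close> gives the two Omega terms. The value at weight 3 follows from
  the same formula, as the code has no words of weight 3, by Pascal's rule.\<close>

lemma distr_D1_coset_of:
  assumes "coset_weight (coset_of s) = 1"
  shows "distr_D1 (coset_of 0) (coset_of s)"
proof -
  note s0 = syndrome_nonzero[of s]
  have general: "int (weight_count (coset_of s) w) =
      int (weight_count (coset_of 0) w) - Omega4 0 w CARD('n) + Omega4 1 w CARD('n)" if "3 \<le> w" for w
  proof -
    have "weight_count (coset_of s) (Suc 0) = 1"
      using weight_count_coset_weight_1[OF assms] by simp
    then show ?thesis
      using that assms s0 length_ge weight_count_coset_weight_1(2)[OF assms]
        Omega4_1[of w "CARD('n)"]
      by (simp add: weight_count_coset_of[of s w] Omega4_0 of_nat_diff algebra_simps)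
  qed
  have "int (weight_count (coset_of s) 3) = int ((CARD('n) - 1) choose 3)"
  proof -
    have "int (weight_count (coset_of s) 3) = - Omega4 0 3 CARD('n) + Omega4 1 3 CARD('n)"
      by (simp add: general weight_count_coset_of_0_eq_0)
    also have "\<dots> = int (CARD('n) choose 3) - int ((CARD('n) - 1) choose 2)"
      by (simp add: Omega4_def)
    also have "\<dots> = int ((CARD('n) - 1) choose 3)"
      using length_ge by (cases "CARD('n)") (auto simp: numeral_eq_Suc)
    finally show ?thesis .
  qed
  then have "weight_count (coset_of s) 3 = (CARD('n) - 1) choose 3"
    by (simp only: of_nat_eq_iff)
  then show ?thesis
    using assms s0 general weight_count_coset_weight_1[OF assms]
    by (simp add: distr_D1_def weight_count_coset_of_0)
qed

text \<open>With \<open>B_1 = 0\<close> only \<open>B_2\<close> remains as a parameter of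
  \<open>weight_count_coset_of\<close>.\<close>

lemma distr_D2_coset_of:
  assumes "coset_weight (coset_of s) = 2"
  shows "distr_D2 (weight_count (coset_of s) 2) (coset_of 0) (coset_of s)"
proof -
  have B: "weight_count (coset_of s) 0 = 0" "weight_count (coset_of s) (Suc 0) = 0"
    using assms coset_weight_eq_iff[OF coset_of_nonempty, of s 2] by auto
  have "int (weight_count (coset_of s) w) = int (weight_count (coset_of 0) w) - Omega4 0 w CARD('n)
      + (-1) ^ w * int ((CARD('n) - 2) choose (CARD('n) - w)) * int (weight_count (coset_of s) 2)"
    if "w \<in> {3..CARD('n)}" for w
  proof -
    have "CARD('n) - 2 - (w - 2) = CARD('n) - w"
      using that by auto
    \<comment> \<open>\<open>distr_D2\<close> uses the complementary lower index of the binomial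
      that comes out of the inversion.\<close>
    then have bin: "(CARD('n) - 2) choose (CARD('n) - w) = (CARD('n) - 2) choose (w - 2)"
      using that binomial_symmetric[of "w - 2" "CARD('n) - 2"] by (auto simp del: diff_diff_left)
    have "s \<noteq> 0" "3 \<le> w" "2 \<le> w"
      using that assms syndrome_nonzero[of s] by auto
    then show ?thesis
      unfolding bin by (simp add: weight_count_coset_of[of s w] Omega4_0 B algebra_simps)
  qed
  then show ?thesis
    using B by (simp add: distr_D2_def)
qed

lemma distr_D3_coset_of:
  assumes "coset_weight (coset_of s) = 3"
  shows "distr_D3 (coset_of 0) (coset_of s)"
proof -
  have B: "weight_count (coset_of s) 0 = 0" "weight_count (coset_of s) (Suc 0) = 0" "weight_count (coset_of s) 2 = 0"
    using assms coset_weight_eq_iff[OF coset_of_nonempty, of s 3] by auto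
  have general: "int (weight_count (coset_of s) w) = int (weight_count (coset_of 0) w) - Omega4 0 w CARD('n)"
    if "3 \<le> w" for w
    using that assms B syndrome_nonzero[of s]
    by (simp add: weight_count_coset_of[of s w] Omega4_0 algebra_simps)
  have "int (weight_count (coset_of s) 3) = int (CARD('n) choose 3)"
    by (simp add: general weight_count_coset_of_0_eq_0 Omega4_def)
  then have "weight_count (coset_of s) 3 = CARD('n) choose 3"
    by (simp only: of_nat_eq_iff)
  then show ?thesis
    using B general by (simp add: distr_D3_def)
qed

section \<open>Counting syndromes by coset weight\<close>

lemma card_coset_weight_0: "card {s. coset_weight (coset_of s) = 0} = 1"
proof -
  have "{s. coset_weight (coset_of s) = 0} = {0}"
    by (auto simp: coset_weight_eq_iff[OF coset_of_nonempty] weight_count_coset_of_0 split: if_splits)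
  then show ?thesis
    by simp
qed

text \<open>The syndrome map is injective on the vectors of weight 1, so these are simply
  counted.\<close>

lemma card_coset_weight_1: "card {s. coset_weight (coset_of s) = 1} = CARD('n) * (CARD('a) - 1)"
proof -
  have "{s. coset_weight (coset_of s) = 1} = (*v) H ` {x. hamming_weight x = 1}"
  proof (intro equalityI subsetI)
    fix s assume "s \<in> {s. coset_weight (coset_of s) = 1}"
    then obtain x where "x \<in> coset_of s" "hamming_weight x = 1"
      by (auto simp: coset_weight_eq_iff[OF coset_of_nonempty] weight_count_eq_0_iff)
    then show "s \<in> (*v) H ` {x. hamming_weight x = 1}"
      by (auto simp: coset_of_def)
  next
    fix s assume "s \<in> (*v) H ` {x. hamming_weight x = 1}"
    then obtain x where x: "hamming_weight x = 1" "s = H *v x"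
      by blast
    have "x \<noteq> 0"
      using x(1) by auto
    then have "s \<noteq> 0"
      using independent[of x] x by auto
    moreover have "weight_count (coset_of s) 1 \<noteq> 0"
      unfolding weight_count_eq_0_iff using x by (simp add: coset_of_def) blast
    ultimately show "s \<in> {s. coset_weight (coset_of s) = 1}"
      by (simp add: coset_weight_eq_iff[OF coset_of_nonempty] weight_count_coset_of_0)
  qed
  moreover have "inj_on ((*v) H) {x. hamming_weight x = 1}"
  proof (rule inj_onI)
    fix x y assume "x \<in> {x. hamming_weight x = 1}" "y \<in> {x. hamming_weight x = 1}" "H *v x = H *v y"
    then show "x = y"
      by (intro coset_of_eqI[of x "H *v x" y]) (auto simp: coset_of_def)
  qed
  ultimately show ?thesis
    by (simp add: card_image card_hamming_weight)
qed

lemma card_coset_weights: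
  "card {s. coset_weight (coset_of s) = 2} + card {s. coset_weight (coset_of s) = 3}
    + CARD('n) * (CARD('a) - 1) + 1 = CARD('a) ^ 3"
proof -
  have "CARD('a) ^ 3 = (\<Sum>s\<in>(UNIV :: ('a ^ 3) set). 1)"
    by simp
  also have "\<dots> = (\<Sum>w\<le>3. \<Sum>s | s \<in> UNIV \<and> coset_weight (coset_of s) = w. 1)"
    using coset_weight_le_3 by (intro sum.group[symmetric]) auto
  also have "\<dots> = (\<Sum>w\<in>{0,1,2,3}. card {s. coset_weight (coset_of s) = w})"
    by (intro sum.cong) auto
  finally show ?thesis
    using card_coset_weight_0 card_coset_weight_1 by simp
qed

text \<open>All vectors of weight 2 are counted by their syndromes. Cosets of weight 0, 1 or 3
  contain none of them.\<close>

lemma sum_weight_count_2: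
  "(\<Sum>s | coset_weight (coset_of s) = 2. weight_count (coset_of s) 2)
    = (CARD('n) choose 2) * (CARD('a) - 1)\<^sup>2"
proof -
  have zero: "weight_count (coset_of s) 2 = 0" if "coset_weight (coset_of s) \<noteq> 2" for s
  proof -
    have "coset_weight (coset_of s) = 0 \<or> coset_weight (coset_of s) = 1 \<or> coset_weight (coset_of s) = 3"
      using coset_weight_le_3[of s] that by arith
    then show ?thesis
    proof (elim disjE)
      assume "coset_weight (coset_of s) = 0"
      then have "s = 0"
        using coset_weight_eq_iff[OF coset_of_nonempty, of s 0] weight_count_coset_of_0[of s] by (auto split: if_splits)
      then show ?thesis
        by (simp add: weight_count_coset_of_0_eq_0)
    next
      assume "coset_weight (coset_of s) = 1"
      then show ?thesis
        by (rule weight_count_coset_weight_1)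
    next
      assume "coset_weight (coset_of s) = 3"
      then show ?thesis
        using coset_weight_eq_iff[OF coset_of_nonempty, of s 3] by auto
    qed
  qed
  have "(CARD('n) choose 2) * (CARD('a) - 1)\<^sup>2 = (\<Sum>x | hamming_weight (x :: 'a ^ 'n) = 2. 1)"
    by (simp add: card_hamming_weight)
  also have "\<dots> = (\<Sum>s\<in>UNIV. \<Sum>x | x \<in> {x. hamming_weight x = 2} \<and> H *v x = s. 1)"
    by (rule sum.group[symmetric]) auto
  also have "\<dots> = (\<Sum>s\<in>UNIV. weight_count (coset_of s) 2)"
    by (simp add: weight_count_def coset_of_def conj_commute)
  also have "\<dots> = (\<Sum>s | coset_weight (coset_of s) = 2. weight_count (coset_of s) 2)"
    by (rule sum.mono_neutral_right) (auto simp: zero)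
  finally show ?thesis
    by simp
qed

end

text \<open>The two counts at weight \<open>v\<close> differ by (-1)^v C(n-2,n-v) (i-j). Replacing
  \<open>v\<close> by n+2-v keeps the binomial and multiplies the sign by (-1)^n.\<close>

lemma distr_D2_symmetry:
  fixes C Va Vb :: "(('a::zero) ^ 'n) set"
  assumes "distr_D2 i C Va" "distr_D2 j C Vb" "w \<in> {3..CARD('n)}"
  shows "(- 1) ^ CARD('n) * int (weight_count Va w) - int (weight_count Va (CARD('n) + 2 - w))
    = (- 1) ^ CARD('n) * int (weight_count Vb w) - int (weight_count Vb (CARD('n) + 2 - w))"
proof -
  let ?n = "CARD('n)"
  have diff: "int (weight_count Va v) - int (weight_count Vb v)
      = (- 1) ^ v * int ((?n - 2) choose (?n - v)) * (int i - int j)" if "v \<in> {2..?n}" for v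
  \<comment> \<open>The reflected weight equals 2 when \<open>w\<close> is the length. There
    \<open>distr_D2\<close> prescribes the count directly, and it fits the same formula.\<close>
  proof (cases "v = 2")
    case True
    then show ?thesis
      using assms by (simp add: distr_D2_def)
  next
    case False
    then have "v \<in> {3..?n}"
      using that by auto
    then have "int (weight_count V v) = int (weight_count C v) - Omega4 0 v ?n
        + (- 1) ^ v * int ((?n - 2) choose (?n - v)) * int m" if "distr_D2 m C V" for V m
      using that by (simp add: distr_D2_def)
    from this[OF assms(1)] this[OF assms(2)] show ?thesis
      by (simp add: algebra_simps)
  qed
  have w: "3 \<le> w" "w \<le> ?n"
    using assms(3) by auto
  then obtain k where k: "?n = w + k"
    using le_Suc_ex by blast
  have "?n - 2 - (?n - w) = ?n - (?n + 2 - w)"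
    using w by auto
  then have bin: "(?n - 2) choose (?n - w) = (?n - 2) choose (?n - (?n + 2 - w))"
    using w binomial_symmetric[of "?n - w" "?n - 2"] by simp
  have "(- 1 :: int) ^ ?n * (- 1) ^ w = (- 1) ^ (?n + 2 - w)"
    using k w by (simp add: power_add flip: power_mult_distrib)
  moreover have "w \<in> {2..?n}" "?n + 2 - w \<in> {2..?n}"
    using w by auto
  ultimately have "(- 1) ^ ?n * (int (weight_count Va w) - int (weight_count Vb w))
      = int (weight_count Va (?n + 2 - w)) - int (weight_count Vb (?n + 2 - w))"
    by (simp only: diff bin flip: mult.assoc)
  then show ?thesis
    by (simp add: algebra_simps)
qed

section \<open>Secants and tangents of the conic\<close>

text \<open>The linear form of the line joining two points of the conic, or of the tangent if they coincide.\<close>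

fun chord :: "'a::field option \<Rightarrow> 'a option \<Rightarrow> 'a ^ 3 \<Rightarrow> 'a"
  where
    "chord (Some t) (Some u) s = s $ 3 - (t + u) * s $ 2 + t * u * s $ 1"
  | "chord (Some t) None s = s $ 2 - t * s $ 1"
  | "chord None (Some u) s = s $ 2 - u * s $ 1"
  | "chord None None s = s $ 1"

text \<open>On a finite conic point with parameter v, the form of the chord through t and u takes
  the value (v-t)(v-u), so the line meets the conic only in its two defining points.\<close>

lemma chord_conic_point_eq_0_iff:
  "chord a b (conic_point c) = 0 \<longleftrightarrow> c = a \<or> c = b"
proof (cases c)
  case None
  then show ?thesis
    by (cases a; cases b) auto
next
  case (Some v)
  have "v\<^sup>2 - (t + u) * v + t * u = (v - t) * (v - u)" for t u
    by (simp add: algebra_simps power2_eq_square)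
  then show ?thesis
    using Some by (cases a; cases b) auto
qed

lemma chord_lincomb:
  "finite A \<Longrightarrow> chord a b (\<Sum>j\<in>A. c j *s v j) = (\<Sum>j\<in>A. c j * chord a b (v j))"
  by (induction A rule: finite_induct; cases a; cases b) (simp_all add: algebra_simps)

text \<open>A point off the tangent at \<open>a\<close> lies on a chord through \<open>a\<close>:
  the chord equation is linear in the second parameter, and \<open>None\<close> is the solution when
  the leading coefficient vanishes.\<close>

lemma exists_chord_eq_0:
  assumes "chord a a s \<noteq> 0"
  shows "\<exists>b. b \<noteq> a \<and> chord a b s = 0"
proof (cases a)
  case None
  then have "chord a (Some (s $ 2 / s $ 1)) s = 0"
    using assms by simp
  then show ?thesis
    using None by blast
next
  case (Some t)
  show ?thesis
  proof (cases "s $ 2 = t * s $ 1")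
    case True
    then show ?thesis
      using Some by (intro exI[of _ None]) simp
  next
    case False
    define u where "u = (t * s $ 2 - s $ 3) / (t * s $ 1 - s $ 2)"
    have "u * (t * s $ 1 - s $ 2) = t * s $ 2 - s $ 3"
      using False by (simp add: u_def)
    then have "chord a (Some u) s = 0"
      using Some by (simp add: algebra_simps)
    then show ?thesis
      using assms by metis
  qed
qed

text \<open>Tangency at t is the equation s3 - 2 t s2 + t^2 s1 = 0, with \<open>None\<close> as a
  further root when s1 = 0. Three roots force all coefficients to vanish, and 2 being nonzero then
  gives s = 0.\<close>

lemma card_tangents_le_2:
  fixes s :: "'a::{field,finite} ^ 3"
  assumes "(2 :: 'a) \<noteq> 0" "s \<noteq> 0"
  shows "card {a. chord a a s = 0} \<le> 2"
proof (rule ccontr)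
  assume "\<not> ?thesis"
  then obtain T where "T \<subseteq> {a. chord a a s = 0}" "card T = 3"
    using obtain_subset_with_card_n[of 3 "{a. chord a a s = 0}"] by auto
  then obtain a b c where abc: "a \<noteq> b" "b \<noteq> c" "a \<noteq> c"
    "chord a a s = 0" "chord b b s = 0" "chord c c s = 0"
    by (auto simp: card_3_iff)
  have two: "s $ 1 = 0 \<and> s $ 2 = 0 \<and> s $ 3 = 0"
    if "s $ 1 = 0" "t \<noteq> u" "chord (Some t) (Some t) s = 0" "chord (Some u) (Some u) s = 0" for t u
  proof -
    have "2 * (t - u) * s $ 2 = 0"
      using that by (simp add: algebra_simps)
    then show ?thesis
      using that assms(1) by simp
  qed
  \<comment> \<open>The sum of the roots, obtained by dividing the difference of two tangency
    equations by t - u.\<close>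
  have slope: "(t + u) * s $ 1 = 2 * s $ 2"
    if "t \<noteq> u" "chord (Some t) (Some t) s = 0" "chord (Some u) (Some u) s = 0" for t u
  proof -
    have "(t - u) * ((t + u) * s $ 1 - 2 * s $ 2)
        = chord (Some t) (Some t) s - chord (Some u) (Some u) s"
      by (simp add: algebra_simps)
    also have "\<dots> = 0"
      by (simp only: that diff_self)
    finally show ?thesis
      using that(1) by simp
  qed
  have "s $ 1 = 0 \<and> s $ 2 = 0 \<and> s $ 3 = 0"
  proof (cases "None \<in> {a, b, c}")
    case True
    then have "s $ 1 = 0"
      using abc by auto
    moreover obtain t u where "t \<noteq> u" "{Some t, Some u} \<subseteq> {a, b, c}"
      using abc(1-3) by (cases a; cases b; cases c) auto
    ultimately show ?thesis
      using two[of t u] abc(4-6) by auto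
  next
    case False
    then obtain t u v where tuv: "a = Some t" "b = Some u" "c = Some v"
      by (metis insertCI not_None_eq)
    have "(t + u) * s $ 1 = (t + v) * s $ 1"
      using slope[of t u] slope[of t v] abc tuv by simp
    then have "s $ 1 = 0"
      using abc tuv by simp
    then show ?thesis
      using two[of t u] abc tuv by simp
  qed
  then have "s = 0"
    by (simp add: vec_eq_iff forall_3)
  then show False
    using assms(2) by simp
qed

text \<open>In characteristic 2 the middle term disappears and tangency reads s3 + t^2 s1 = 0;
  squaring is injective, so there is at most one root. The assumption on \<open>s\<close> excludes
  zero and the nucleus (0,1,0).\<close>

lemma card_tangents_char_2:
  fixes s :: "'a::{field,finite} ^ 3"
  assumes two: "(2 :: 'a) = 0" and s: "s $ 1 \<noteq> 0 \<or> s $ 3 \<noteq> 0"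
  shows "card {a. chord a a s = 0} \<le> 1"
proof -
  have tangent: "chord (Some t) (Some t) s = s $ 3 + t * t * s $ 1" for t
    using two by (simp flip: mult_2)
  have "a = b" if "chord a a s = 0" "chord b b s = 0" for a b
  proof -
    have eq: "t = u"
      if "s $ 3 + t * t * s $ 1 = 0" "s $ 3 + u * u * s $ 1 = 0" for t u
    proof -
      \<comment> \<open>The last summand corrects t^2 - u^2 to (t-u)^2 and vanishes because 2 =
        0.\<close>
      have "(t - u) * (t - u) * s $ 1
          = (s $ 3 + t * t * s $ 1) - (s $ 3 + u * u * s $ 1) + 2 * (u * (u - t) * s $ 1)"
        by (simp add: algebra_simps)
      also have "\<dots> = 0"
        by (simp only: that two) simp
      finally have "t = u \<or> s $ 1 = 0"
        by simp
      then show ?thesis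
        using that s by auto
    qed
    show ?thesis
      using that s by (cases a; cases b) (auto simp: tangent simp del: chord.simps(1) intro: eq)
  qed
  then show ?thesis
    by (auto simp: card_le_Suc0_iff_eq)
qed

lemma tangent_nucleus:
  fixes s :: "'a::field ^ 3"
  assumes "(2 :: 'a) = 0" "s $ 1 = 0" "s $ 3 = 0"
  shows "chord a a s = 0"
  using assms by (cases a) (simp_all flip: mult_2)

text \<open>One direction: the characteristic divides the order of the field. The other: negation
  permutes the nonzero elements, so comparing their product with itself gives 1 = (-1)^(q-1), where
  q - 1 is odd.\<close>

lemma two_eq_0_iff_even_card: "(2 :: 'a::{field,finite}) = 0 \<longleftrightarrow> even CARD('a)"
proof
  assume "(2 :: 'a) = 0"
  then have "of_nat 2 = (0 :: 'a)"
    by simp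
  then have "CHAR('a) dvd 2"
    by (simp only: of_nat_eq_0_iff_char_dvd)
  then have "CHAR('a) = 1 \<or> CHAR('a) = 2"
    using two_is_prime_nat prime_nat_iff by blast
  moreover have "CHAR('a) \<noteq> 1"
    using of_nat_CHAR[where ?'a = 'a] by auto
  ultimately show "even CARD('a)"
    using CHAR_dvd_CARD[where ?'a = 'a] by simp
next
  assume "even CARD('a)"
  then have odd: "odd (CARD('a) - 1)"
    by simp
  have "(\<Prod>y\<in>UNIV - {0 :: 'a}. y) = (\<Prod>y\<in>UNIV - {0 :: 'a}. - 1 * y)"
    by (rule prod.reindex_bij_witness[of _ uminus uminus]) auto
  also have "\<dots> = (- 1) ^ (CARD('a) - 1) * (\<Prod>y\<in>UNIV - {0 :: 'a}. y)"
    by (subst prod.distrib) simp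
  finally have "1 = (- 1 :: 'a)"
    using odd by simp
  then have "1 + 1 = (0 :: 'a)"
    by (metis add.right_inverse)
  then show "(2 :: 'a) = 0"
    by simp
qed

section \<open>The code of the conic: weight 2 vectors and tangents\<close>

locale gdrs =
  fixes H :: "('a::{field,finite}) ^ 'n ^ 3" and p :: "'n \<Rightarrow> 'a option" and u :: "'n \<Rightarrow> 'a"
  assumes bij_p: "bij p"
    and u_nonzero: "u j \<noteq> 0"
    and column_H: "column j H = u j *s conic_point (p j)"
    and card_field: "3 \<le> CARD('a)"
begin

lemma card_length: "CARD('n) = CARD('a) + 1"
proof -
  have "CARD('n) = CARD('a option)"
    using bij_p by (rule bij_betw_same_card)
  then show ?thesis
    by (simp add: card_UNIV_option)
qed

text \<open>The line form through the points of \<open>j\<close> and \<open>k\<close> kills their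
  columns, leaving a nonzero multiple of \<open>x $ i\<close>. The case \<open>j = k\<close>, the
  tangent, is deliberately included.\<close>

lemma chord_syndrome:
  assumes "i \<noteq> j" "i \<noteq> k" "{m. x $ m \<noteq> 0} \<subseteq> {i, j, k}"
  shows "chord (p j) (p k) (H *v x) = 0 \<longleftrightarrow> x $ i = 0"
proof -
  have "H *v x = (\<Sum>m\<in>UNIV. (x $ m * u m) *s conic_point (p m))"
    by (simp add: matrix_mult_sum column_H)
  then have "chord (p j) (p k) (H *v x)
      = (\<Sum>m\<in>UNIV. x $ m * u m * chord (p j) (p k) (conic_point (p m)))"
    by (simp add: chord_lincomb)
  also have "\<dots> = (\<Sum>m\<in>{i}. x $ m * u m * chord (p j) (p k) (conic_point (p m)))"
    using assms(3) by (intro sum.mono_neutral_right) (auto simp: chord_conic_point_eq_0_iff)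
  finally have "chord (p j) (p k) (H *v x) = x $ i * u i * chord (p j) (p k) (conic_point (p i))"
    by simp
  moreover have "p i \<noteq> p j" "p i \<noteq> p k"
    using bij_p assms(1,2) by (auto dest: bij_is_inj injD)
  ultimately show ?thesis
    using u_nonzero by (simp add: chord_conic_point_eq_0_iff)
qed

sublocale mds_check H
proof
  show "4 \<le> CARD('n)"
    using card_field card_length by simp
  fix x :: "'a ^ 'n" assume x: "hamming_weight x \<le> 3" "H *v x = 0"
  have "x $ i = 0" for i
  proof (rule ccontr)
    assume i: "x $ i \<noteq> 0"
    have "card ({m. x $ m \<noteq> 0} - {i}) \<le> 2"
      using x(1) i by (simp add: hamming_weight_def)
    moreover have "2 \<le> card (UNIV - {i})"
      using card_field card_length by simp
    \<comment> \<open>The rest of the support is padded to exactly two positions, so that the chord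
      through them isolates the coordinate \<open>i\<close>.\<close>
    ultimately obtain T where T: "{m. x $ m \<noteq> 0} - {i} \<subseteq> T" "T \<subseteq> UNIV - {i}" "card T = 2"
      using exists_subset_between[of "{m. x $ m \<noteq> 0} - {i}" 2 "UNIV - {i}"] by auto
    then obtain j k where "T = {j, k}"
      by (auto simp: card_2_iff)
    then have "x $ i = 0 \<longleftrightarrow> chord (p j) (p k) (H *v x) = 0"
      using T by (intro chord_syndrome[symmetric]) auto
    moreover have "chord (p j) (p k) 0 = 0"
      by (cases "p j"; cases "p k") auto
    ultimately show False
      using i x(2) by simp
  qed
  then show "x = 0"
    by (simp add: vec_eq_iff)
qed

text \<open>Such a vector expresses \<open>s\<close> by the columns of \<open>j\<close> and of a
  second conic point on the line through \<open>s\<close>; this point exists exactly when the line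
  is not the tangent at \<open>j\<close>.\<close>

lemma weight_2_through_iff:
  assumes "2 \<le> coset_weight (coset_of s)"
  shows "(\<exists>x\<in>coset_of s. hamming_weight x = 2 \<and> x $ j \<noteq> 0) \<longleftrightarrow> chord (p j) (p j) s \<noteq> 0"
proof
  assume "\<exists>x\<in>coset_of s. hamming_weight x = 2 \<and> x $ j \<noteq> 0"
  then obtain x where x: "H *v x = s" "card {m. x $ m \<noteq> 0} = 2" "x $ j \<noteq> 0"
    by (auto simp: coset_of_def hamming_weight_def)
  then have "card ({m. x $ m \<noteq> 0} - {j}) = 1"
    by simp
  then obtain k where k: "{m. x $ m \<noteq> 0} - {j} = {k}"
    by (rule card_1_singletonE)
  then have "k \<in> {m. x $ m \<noteq> 0} - {j}" "{m. x $ m \<noteq> 0} \<subseteq> {k, j, j}"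
    by auto
  then show "chord (p j) (p j) s \<noteq> 0"
    using chord_syndrome[of k j j x] x(1) by simp
next
  assume "chord (p j) (p j) s \<noteq> 0"
  then obtain b where b: "b \<noteq> p j" "chord (p j) b s = 0"
    using exists_chord_eq_0 by blast
  obtain k where k: "p k = b"
    using bij_p by (metis bij_pointE)
  have jk: "j \<noteq> k"
    using b k by auto
  have "card (UNIV - {j, k}) > 0"
    using length_ge by (subst card_Diff_subset) (auto simp: card_insert_if)
  then obtain i where i: "i \<noteq> j" "i \<noteq> k"
    by (auto simp: card_gt_0_iff)
  \<comment> \<open>The auxiliary position \<open>i\<close> makes the syndrome solvable; the chord
    equation then forces \<open>x $ i = 0\<close>, and the coset weight forces both other
    coordinates to be nonzero.\<close>
  obtain x where x: "{m. x $ m \<noteq> 0} \<subseteq> {i, j, k}" "H *v x = s"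
    using exists_supported[of "{i, j, k}" s] i jk by auto
  then have "x $ i = 0"
    using chord_syndrome[OF i x(1)] b k by simp
  then have sub: "{m. x $ m \<noteq> 0} \<subseteq> {j, k}"
    using x(1) by auto
  have "2 \<le> hamming_weight x"
    using assms x(2) coset_weight_le_iff[OF coset_of_nonempty, of s "hamming_weight x"]
    by (auto simp: coset_of_def)
  then have "{m. x $ m \<noteq> 0} = {j, k}"
    using sub jk by (intro card_seteq) (auto simp: hamming_weight_def)
  then show "\<exists>x\<in>coset_of s. hamming_weight x = 2 \<and> x $ j \<noteq> 0"
    using x(2) jk by (intro bexI[of _ x]) (auto simp: coset_of_def hamming_weight_def)
qed

text \<open>The supports of the weight 2 vectors in the coset are disjoint pairs, and they cover
  exactly the positions whose tangent misses \<open>s\<close>.\<close>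

lemma weight_count_2_tangents:
  assumes "2 \<le> coset_weight (coset_of s)"
  shows "2 * weight_count (coset_of s) 2 + card {a. chord a a s = 0} = CARD('n)"
proof -
  let ?X = "{x \<in> coset_of s. hamming_weight x = 2}"
  let ?U = "\<Union>x\<in>?X. {m. x $ m \<noteq> 0}"
  \<comment> \<open>Two such supports sharing a position have a union of at most 3 positions, so the
    difference is a codeword of weight at most 3.\<close>
  have disj: "x = y" if x: "x \<in> ?X" and y: "y \<in> ?X" and j: "x $ j \<noteq> 0" "y $ j \<noteq> 0" for x y j
  proof -
    let ?Sx = "{m. x $ m \<noteq> 0}" and ?Sy = "{m. y $ m \<noteq> 0}"
    have "card (?Sx \<union> ?Sy) + card (?Sx \<inter> ?Sy) = 4"
      using x y by (simp add: hamming_weight_def flip: card_Un_Int)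
    moreover have "card (?Sx \<inter> ?Sy) > 0"
      using j by (auto simp: card_gt_0_iff)
    moreover have "{m. (x - y) $ m \<noteq> 0} \<subseteq> ?Sx \<union> ?Sy"
      by auto
    then have "hamming_weight (x - y) \<le> card (?Sx \<union> ?Sy)"
      unfolding hamming_weight_def by (intro card_mono) auto
    ultimately have "hamming_weight (x - y) \<le> 3"
      by linarith
    moreover have "H *v (x - y) = 0"
      using x y by (simp add: coset_of_def matrix_vector_mult_diff_distrib)
    ultimately show ?thesis
      using independent[of "x - y"] by simp
  qed
  have "card ?U = (\<Sum>x\<in>?X. card {m. x $ m \<noteq> 0})"
  proof (rule card_UN_disjoint)
    show "\<forall>x\<in>?X. \<forall>y\<in>?X. x \<noteq> y \<longrightarrow> {m. x $ m \<noteq> 0} \<inter> {m. y $ m \<noteq> 0} = {}"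
      using disj by blast
  qed auto
  also have "\<dots> = (\<Sum>x\<in>?X. 2)"
    by (intro sum.cong) (auto simp: hamming_weight_def)
  finally have "card ?U = 2 * weight_count (coset_of s) 2"
    by (simp add: weight_count_def)
  moreover have "?U = - {j. chord (p j) (p j) s = 0}"
    using weight_2_through_iff[OF assms] by auto
  moreover have "card {j. chord (p j) (p j) s = 0} = card {a. chord a a s = 0}"
  proof -
    have "{a. chord a a s = 0} = p ` {j. chord (p j) (p j) s = 0}"
      using bij_is_surj[OF bij_p] by (auto simp: image_iff)
    then show ?thesis
      using bij_is_inj[OF bij_p] by (simp add: card_image inj_on_subset[of p UNIV])
  qed
  moreover have "card (- {j. chord (p j) (p j) s = 0}) + card {j. chord (p j) (p j) s = 0} = CARD('n)"
    using card_Un_disjoint[of "- {j. chord (p j) (p j) s = 0}" "{j. chord (p j) (p j) s = 0}"]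
    by (simp add: Un_commute)
  ultimately show ?thesis
    by simp
qed

lemma coset_weight_eq_2I:
  assumes "2 \<le> coset_weight (coset_of s)" "weight_count (coset_of s) 2 \<noteq> 0"
  shows "coset_weight (coset_of s) = 2"
proof -
  have "coset_weight (coset_of s) \<le> 2"
    using assms(2) unfolding coset_weight_le_iff[OF coset_of_nonempty] weight_count_eq_0_iff
    by (metis order.refl)
  with assms(1) show ?thesis
    by simp
qed

text \<open>As q + 1 is even, so is the number of tangents, which is therefore 0 or 2. In both cases
  some vector has weight 2, which rules out coset weight 3.\<close>

lemma odd_field_weight_2:
  assumes "odd CARD('a)" "2 \<le> coset_weight (coset_of s)"
  shows "coset_weight (coset_of s) = 2"
    and "weight_count (coset_of s) 2 = (CARD('a) - 1) div 2 \<or> weight_count (coset_of s) 2 = (CARD('a) + 1) div 2"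
proof -
  have "s \<noteq> 0"
    using assms(2) syndrome_nonzero[of s] by simp
  then have "card {a. chord a a s = 0} \<le> 2"
    using assms(1) two_eq_0_iff_even_card[where ?'a = 'a] by (intro card_tangents_le_2) auto
  moreover have eq: "2 * weight_count (coset_of s) 2 + card {a. chord a a s = 0} = CARD('a) + 1"
    using weight_count_2_tangents[OF assms(2)] card_length by simp
  moreover obtain m where m: "CARD('a) = 2 * m + 1"
    using assms(1) by (rule oddE)
  ultimately show cases: "weight_count (coset_of s) 2 = (CARD('a) - 1) div 2 \<or>
      weight_count (coset_of s) 2 = (CARD('a) + 1) div 2"
    unfolding m by auto
  then have "weight_count (coset_of s) 2 \<noteq> 0"
    using card_field m by auto
  then show "coset_weight (coset_of s) = 2"
    by (rule coset_weight_eq_2I[OF assms(2)])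
qed

lemma odd_field_weight_2_classes:
  assumes "odd CARD('a)"
  shows "{s. coset_weight (coset_of s) = 2}
    = {s. coset_weight (coset_of s) = 2 \<and> weight_count (coset_of s) 2 = (CARD('a) - 1) div 2}
      \<union> {s. coset_weight (coset_of s) = 2 \<and> weight_count (coset_of s) 2 = (CARD('a) + 1) div 2}"
proof -
  have "weight_count (coset_of s) 2 = (CARD('a) - 1) div 2 \<or> weight_count (coset_of s) 2 = (CARD('a) + 1) div 2"
    if "coset_weight (coset_of s) = 2" for s
    using odd_field_weight_2(2)[OF assms, of s] that by linarith
  then show ?thesis
    by blast
qed

text \<open>As q + 1 is odd, so is the number of tangents. It is at most 1, since at the nucleus all
  q + 1 tangents meet and no vector of weight 2 would remain.\<close>

lemma even_field_weight_2:
  assumes "even CARD('a)" "coset_weight (coset_of s) = 2"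
  shows "weight_count (coset_of s) 2 = CARD('a) div 2"
proof -
  have two: "(2 :: 'a) = 0"
    using assms(1) by (simp add: two_eq_0_iff_even_card)
  have eq: "2 * weight_count (coset_of s) 2 + card {a. chord a a s = 0} = CARD('a) + 1"
    using weight_count_2_tangents[of s] assms(2) card_length by simp
  have pos: "weight_count (coset_of s) 2 \<noteq> 0"
    using assms(2) coset_weight_eq_iff[OF coset_of_nonempty, of s 2] by blast
  have "s $ 1 \<noteq> 0 \<or> s $ 3 \<noteq> 0"
  proof (rule ccontr)
    assume "\<not> ?thesis"
    then have "{a. chord a a s = 0} = UNIV"
      using tangent_nucleus[OF two, of s] by auto
    then have "card {a. chord a a s = 0} = CARD('a) + 1"
      by (simp add: card_UNIV_option)
    with eq pos show False
      by simp
  qed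
  then have "card {a. chord a a s = 0} \<le> 1"
    by (rule card_tangents_char_2[OF two])
  moreover obtain m where "CARD('a) = 2 * m"
    using assms(1) by (rule evenE)
  ultimately show ?thesis
    using eq by simp
qed

section \<open>Sizes of the classes of cosets\<close>

lemma card_coset_weights_eq:
  "card {s. coset_weight (coset_of s) = 2} + card {s. coset_weight (coset_of s) = 3}
    = (CARD('a) - 1) * (CARD('a))\<^sup>2"
proof -
  obtain r where r: "CARD('a) = Suc r"
    using card_field by (metis Suc_le_D numeral_3_eq_3)
  show ?thesis
    using card_coset_weights unfolding card_length r by (simp add: power2_eq_square power3_eq_cube algebra_simps)
qed

lemma sum_weight_count_2_eq:
  "2 * (\<Sum>s | coset_weight (coset_of s) = 2. weight_count (coset_of s) 2)
    = (CARD('a) + 1) * CARD('a) * (CARD('a) - 1)\<^sup>2"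
proof -
  have "2 * (CARD('n) choose 2) = (CARD('a) + 1) * CARD('a)"
    unfolding card_length choose_two by simp
  then show ?thesis
    unfolding sum_weight_count_2 by (simp only: flip: mult.assoc)
qed

text \<open>Each coset of weight 2 has q/2 vectors of weight 2, so the total count of these vectors
  determines the number of cosets.\<close>

lemma even_field_card_weight_2:
  assumes "even CARD('a)"
  shows "card {s. coset_weight (coset_of s) = 2} = (CARD('a) - 1) * ((CARD('a))\<^sup>2 - 1)"
proof -
  obtain m where m: "CARD('a) = 2 * m"
    using assms by (rule evenE)
  have "CARD('a) * card {s. coset_weight (coset_of s) = 2} = 2 * (\<Sum>s | coset_weight (coset_of s) = 2. CARD('a) div 2)"
    by (simp add: m)
  also have "(\<Sum>s | coset_weight (coset_of s) = 2. CARD('a) div 2)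
      = (\<Sum>s | coset_weight (coset_of s) = 2. weight_count (coset_of s) 2)"
    using even_field_weight_2[OF assms] by (intro sum.cong) auto
  also have "2 * \<dots> = CARD('a) * ((CARD('a) - 1) * ((CARD('a) - 1) * (CARD('a) + 1)))"
    unfolding sum_weight_count_2_eq by (simp only: power2_eq_square mult_ac)
  finally have "card {s. coset_weight (coset_of s) = 2} = (CARD('a) - 1) * ((CARD('a) - 1) * (CARD('a) + 1))"
    using card_field by simp
  moreover have "(CARD('a) - 1) * (CARD('a) + 1) = (CARD('a))\<^sup>2 - 1"
    by (simp add: power2_eq_square algebra_simps)
  ultimately show ?thesis
    by simp
qed

lemma even_field_card_weight_3:
  assumes "even CARD('a)"
  shows "card {s. coset_weight (coset_of s) = 3} = CARD('a) - 1"
proof -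
  have "(CARD('a))\<^sup>2 \<ge> 1"
    using card_field by simp
  then have "(CARD('a) - 1) * ((CARD('a))\<^sup>2 - 1) + (CARD('a) - 1) = (CARD('a) - 1) * (CARD('a))\<^sup>2"
    by (metis Suc_diff_1 add.commute less_eq_Suc_le mult_Suc_right One_nat_def)
  then show ?thesis
    using card_coset_weights_eq unfolding even_field_card_weight_2[OF assms] by linarith
qed

text \<open>The sizes solve two linear equations: one counts all syndromes of weight 2, the other
  all vectors of weight 2, with multiplicities m and m + 1 where q = 2 m + 1.\<close>

lemma odd_field_card_classes:
  assumes "odd CARD('a)"
  shows "card {s. coset_weight (coset_of s) = 2 \<and> weight_count (coset_of s) 2 = (CARD('a) - 1) div 2}
      = (CARD('a) - 1) * (((CARD('a))\<^sup>2 + CARD('a)) div 2)" (is "card ?K1 = _")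
    and "card {s. coset_weight (coset_of s) = 2 \<and> weight_count (coset_of s) 2 = (CARD('a) + 1) div 2}
      = (CARD('a) - 1) * (((CARD('a))\<^sup>2 - CARD('a)) div 2)" (is "card ?K2 = _")
proof -
  obtain m where m: "CARD('a) = 2 * m + 1"
    using assms by (rule oddE)
  have "{s. coset_weight (coset_of s) = 3} = {}"
  proof -
    have "coset_weight (coset_of s) \<noteq> 3" for s
      using odd_field_weight_2(1)[OF assms, of s] by linarith
    then show ?thesis
      by simp
  qed
  moreover have union: "{s. coset_weight (coset_of s) = 2} = ?K1 \<union> ?K2"
    by (rule odd_field_weight_2_classes[OF assms])
  moreover have disj: "?K1 \<inter> ?K2 = {}"
    using m by auto
  ultimately have "card ?K1 + card ?K2 = (CARD('a) - 1) * (CARD('a))\<^sup>2"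
    using card_coset_weights_eq by (simp add: card_Un_disjoint)
  then have total: "card ?K1 + card ?K2 = 2 * m * (2 * m + 1)\<^sup>2"
    by (simp add: m)
  have "(\<Sum>s | coset_weight (coset_of s) = 2. weight_count (coset_of s) 2)
      = (\<Sum>s\<in>?K1. weight_count (coset_of s) 2) + (\<Sum>s\<in>?K2. weight_count (coset_of s) 2)"
    unfolding union using disj by (intro sum.union_disjoint) auto
  also have "\<dots> = card ?K1 * m + card ?K2 * (m + 1)"
    by (simp add: m)
  finally have "2 * (card ?K1 * m + card ?K2 * (m + 1)) = (2 * m + 2) * (2 * m + 1) * (2 * m)\<^sup>2"
    using sum_weight_count_2_eq by (simp add: m)
  \<comment> \<open>Inserting the known total on the right isolates the size of the second
    class.\<close>
  moreover have "card ?K1 * m + card ?K2 * (m + 1) = (card ?K1 + card ?K2) * m + card ?K2"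
    by (simp add: algebra_simps)
  ultimately have "2 * (2 * m * (2 * m + 1)\<^sup>2 * m + card ?K2) = (2 * m + 2) * (2 * m + 1) * (2 * m)\<^sup>2"
    using total by simp
  then have K2: "card ?K2 = 2 * m * ((2 * m + 1) * m)"
    by (simp add: power2_eq_square algebra_simps)
  then have K1: "card ?K1 = 2 * m * ((2 * m + 1) * (m + 1))"
    using total by (simp add: power2_eq_square algebra_simps)
  have "((2 * m + 1)\<^sup>2 + (2 * m + 1)) div 2 = (2 * m + 1) * (m + 1)"
    "((2 * m + 1)\<^sup>2 - (2 * m + 1)) div 2 = (2 * m + 1) * m"
    by (simp_all add: power2_eq_square algebra_simps)
  with K1 K2 show "card ?K1 = (CARD('a) - 1) * (((CARD('a))\<^sup>2 + CARD('a)) div 2)"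
    "card ?K2 = (CARD('a) - 1) * (((CARD('a))\<^sup>2 - CARD('a)) div 2)"
    unfolding m by simp_all
qed

lemma odd_field_classification:
  assumes "odd CARD('a)"
  shows "covering_radius (coset_of 0) = 2"
    and "cosets_of_weight 3 (coset_of 0) = {}"
    and "\<exists>K1 K2. K1 \<union> K2 = cosets_of_weight 2 (coset_of 0) \<and> K1 \<inter> K2 = {} \<and>
      card K1 = (CARD('a) - 1) * (((CARD('a))\<^sup>2 + CARD('a)) div 2) \<and>
      (\<forall>V\<in>K1. distr_D2 ((CARD('a) - 1) div 2) (coset_of 0) V) \<and>
      card K2 = (CARD('a) - 1) * (((CARD('a))\<^sup>2 - CARD('a)) div 2) \<and>
      (\<forall>V\<in>K2. distr_D2 ((CARD('a) + 1) div 2) (coset_of 0) V)"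
proof -
  let ?W = "\<lambda>i. {s. coset_weight (coset_of s) = 2 \<and> weight_count (coset_of s) 2 = i}"
  let ?i1 = "(CARD('a) - 1) div 2" and ?i2 = "(CARD('a) + 1) div 2"
  have le: "coset_weight (coset_of s) \<le> 2" for s
    using odd_field_weight_2(1)[OF assms, of s] by linarith
  have "(CARD('a) - 1) * (((CARD('a))\<^sup>2 + CARD('a)) div 2) \<noteq> 0"
    using card_field by (simp add: power2_eq_square div_eq_0_iff)
  \<comment> \<open>A nonempty class shows that weight 2 is attained, so the covering radius is not
    smaller.\<close>
  then have "?W ?i1 \<noteq> {}"
    using odd_field_card_classes(1)[OF assms] by (metis card.empty)
  then have "card {s. coset_weight (coset_of s) = 2} \<noteq> 0"
    by auto
  with le show "covering_radius (coset_of 0) = 2"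
    by (rule covering_radius_eqI)
  show "cosets_of_weight 3 (coset_of 0) = {}"
  proof -
    have "coset_weight (coset_of s) \<noteq> 3" for s
      using le[of s] by linarith
    then show ?thesis
      by (simp add: cosets_of_weight_eq)
  qed
  have "{s. coset_weight (coset_of s) = 2} = ?W ?i1 \<union> ?W ?i2"
    by (rule odd_field_weight_2_classes[OF assms])
  then have union: "coset_of ` ?W ?i1 \<union> coset_of ` ?W ?i2 = cosets_of_weight 2 (coset_of 0)"
    unfolding cosets_of_weight_eq by (simp only: image_Un)
  have ne: "?i1 \<noteq> ?i2"
    using assms by (auto elim: oddE)
  have disj: "coset_of ` ?W ?i1 \<inter> coset_of ` ?W ?i2 = {}"
  proof -
    have "False" if "V \<in> coset_of ` ?W ?i1" "V \<in> coset_of ` ?W ?i2" for V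
    proof -
      from that have "weight_count V 2 = ?i1" "weight_count V 2 = ?i2"
        by (auto simp only: mem_Collect_eq)
      with ne show False
        by metis
    qed
    then show ?thesis
      by blast
  qed
  have card: "card (coset_of ` ?W i) = card (?W i)" for i
    by (simp add: card_image inj_on_subset[OF inj_coset_of])
  have distr: "\<forall>V\<in>coset_of ` ?W i. distr_D2 i (coset_of 0) V" for i
    using distr_D2_coset_of by blast
  show "\<exists>K1 K2. K1 \<union> K2 = cosets_of_weight 2 (coset_of 0) \<and> K1 \<inter> K2 = {} \<and>
      card K1 = (CARD('a) - 1) * (((CARD('a))\<^sup>2 + CARD('a)) div 2) \<and>
      (\<forall>V\<in>K1. distr_D2 ?i1 (coset_of 0) V) \<and>
      card K2 = (CARD('a) - 1) * (((CARD('a))\<^sup>2 - CARD('a)) div 2) \<and>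
      (\<forall>V\<in>K2. distr_D2 ?i2 (coset_of 0) V)"
    using union disj distr[of ?i1] distr[of ?i2] odd_field_card_classes[OF assms]
    by - (rule exI[of _ "coset_of ` ?W ?i1"], rule exI[of _ "coset_of ` ?W ?i2"], simp only: card simp_thms)
qed

lemma even_field_covering_radius:
  assumes "even CARD('a)"
  shows "covering_radius (coset_of 0) = 3"
  using coset_weight_le_3 even_field_card_weight_3[OF assms] card_field
  by (intro covering_radius_eqI) auto

end

theorem theorem6p4:
  fixes H :: "('a::{field,finite}) ^ 'n ^ 3"
    and C :: "('a ^ 'n) set"
    and q n :: nat
  assumes "CARD('a) = q" and "q \<ge> 3" and "n = q + 1"
    and "gdrs_parity_check H"
    and "C = code_of_parity_check H"
  shows "linear_code n (q - 2) 4 C \<and>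
    (odd q \<longrightarrow>
      covering_radius C = 2 \<and>
      card (cosets_of_weight 1 C) = (q + 1) * (q - 1) \<and>
      (\<forall>V\<in>cosets_of_weight 1 C. distr_D1 C V) \<and>
      (\<exists>K1 K2. K1 \<union> K2 = cosets_of_weight 2 C \<and> K1 \<inter> K2 = {} \<and>
        card K1 = (q - 1) * ((q\<^sup>2 + q) div 2) \<and>
        (\<forall>V\<in>K1. distr_D2 ((q - 1) div 2) C V) \<and>
        card K2 = (q - 1) * ((q\<^sup>2 - q) div 2) \<and>
        (\<forall>V\<in>K2. distr_D2 ((q + 1) div 2) C V) \<and>
        (\<forall>Va\<in>K1. \<forall>Vb\<in>K2. \<forall>w\<in>{3..n}.
          (-1) ^ n * int (weight_count Va w) - int (weight_count Va (n + 2 - w)) =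
          (-1) ^ n * int (weight_count Vb w) - int (weight_count Vb (n + 2 - w)))) \<and>
      cosets_of_weight 3 C = {}) \<and>
    (even q \<longrightarrow>
      covering_radius C = 3 \<and>
      card (cosets_of_weight 1 C) = (q + 1) * (q - 1) \<and>
      (\<forall>V\<in>cosets_of_weight 1 C. distr_D1 C V) \<and>
      card (cosets_of_weight 2 C) = (q - 1) * (q\<^sup>2 - 1) \<and>
      (\<forall>V\<in>cosets_of_weight 2 C. distr_D2 (q div 2) C V) \<and>
      card (cosets_of_weight 3 C) = q - 1 \<and>
      (\<forall>V\<in>cosets_of_weight 3 C. distr_D3 C V))"
proof -
  from assms(4) obtain p :: "'n \<Rightarrow> 'a option" and u :: "'n \<Rightarrow> 'a" where
    pu: "bij p" "\<And>j. u j \<noteq> 0" "\<And>j. column j H = u j *s conic_point (p j)"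
    unfolding gdrs_parity_check_def by blast
  interpret gdrs H p u
    using assms(1,2) pu by unfold_locales auto
  \<comment> \<open>The code is the fibre of the zero syndrome, so the results of both locales
    apply.\<close>
  have C: "C = coset_of 0"
    using assms(5) by (simp add: code_of_parity_check_def coset_of_def)
  have n: "CARD('n) = n"
    using card_length assms(1,3) by simp
  have code: "linear_code n (q - 2) 4 C"
    using linear_code_coset_of_0 assms(1,3) C n by simp
  have card1: "card (cosets_of_weight 1 C) = (q + 1) * (q - 1)"
    unfolding C card_cosets_of_weight card_coset_weight_1 using n assms(1,3) by simp
  have D1: "\<forall>V\<in>cosets_of_weight 1 C. distr_D1 C V"
    unfolding C cosets_of_weight_eq using distr_D1_coset_of by blast
  have odd_case: "covering_radius C = 2 \<and> cosets_of_weight 3 C = {} \<and>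
      (\<exists>K1 K2. K1 \<union> K2 = cosets_of_weight 2 C \<and> K1 \<inter> K2 = {} \<and>
        card K1 = (q - 1) * ((q\<^sup>2 + q) div 2) \<and>
        (\<forall>V\<in>K1. distr_D2 ((q - 1) div 2) C V) \<and>
        card K2 = (q - 1) * ((q\<^sup>2 - q) div 2) \<and>
        (\<forall>V\<in>K2. distr_D2 ((q + 1) div 2) C V) \<and>
        (\<forall>Va\<in>K1. \<forall>Vb\<in>K2. \<forall>w\<in>{3..n}.
          (-1) ^ n * int (weight_count Va w) - int (weight_count Va (n + 2 - w)) =
          (-1) ^ n * int (weight_count Vb w) - int (weight_count Vb (n + 2 - w))))" if "odd q"
  proof -
    have odd: "odd CARD('a)"
      using that assms(1) by simp
    note cls = odd_field_classification[OF odd, unfolded assms(1) C[symmetric]]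
    from cls(3) obtain K1 K2 where K: "K1 \<union> K2 = cosets_of_weight 2 C" "K1 \<inter> K2 = {}"
      "card K1 = (q - 1) * ((q\<^sup>2 + q) div 2)" "\<forall>V\<in>K1. distr_D2 ((q - 1) div 2) C V"
      "card K2 = (q - 1) * ((q\<^sup>2 - q) div 2)" "\<forall>V\<in>K2. distr_D2 ((q + 1) div 2) C V"
      by blast
    have "\<forall>Va\<in>K1. \<forall>Vb\<in>K2. \<forall>w\<in>{3..n}.
        (-1) ^ n * int (weight_count Va w) - int (weight_count Va (n + 2 - w)) =
        (-1) ^ n * int (weight_count Vb w) - int (weight_count Vb (n + 2 - w))"
      using distr_D2_symmetry[of _ C, unfolded n] K(4,6) by blast
    with cls(1,2) K show ?thesis
      by blast
  qed
  have even_case: "covering_radius C = 3 \<and>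
      card (cosets_of_weight 2 C) = (q - 1) * (q\<^sup>2 - 1) \<and>
      (\<forall>V\<in>cosets_of_weight 2 C. distr_D2 (q div 2) C V) \<and>
      card (cosets_of_weight 3 C) = q - 1 \<and>
      (\<forall>V\<in>cosets_of_weight 3 C. distr_D3 C V)" if "even q"
  proof -
    have even: "even CARD('a)"
      using that assms(1) by simp
    have "distr_D2 (q div 2) C (coset_of s)" if "coset_weight (coset_of s) = 2" for s
      using distr_D2_coset_of[OF that] even_field_weight_2[OF even that] assms(1) C by simp
    then have "\<forall>V\<in>cosets_of_weight 2 C. distr_D2 (q div 2) C V"
      unfolding C cosets_of_weight_eq by blast
    moreover have "\<forall>V\<in>cosets_of_weight 3 C. distr_D3 C V"
      unfolding C cosets_of_weight_eq using distr_D3_coset_of by blast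
    ultimately show ?thesis
      using even_field_covering_radius[OF even] even_field_card_weight_2[OF even]
        even_field_card_weight_3[OF even]
      by (simp add: C card_cosets_of_weight assms(1))
  qed
  show ?thesis
    using code card1 D1 odd_case even_case by simp
qed

end
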